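(* Let $f\in\mathcal{F}_{0,U}$, for an open connected subset $U$ of $\mathbb{H}_0$. If $f$ is left $0$-regular on $U$, then $f$ is $0$-harmonic on $U$.
   Context: $\mathbb{H}_0$ (the $0$-scaled hypercomplexes) is the associative unital real algebra with $\mathbb{R}$-basis $\{1,i,j_0,k_0\}$ and multiplication determined by $i^2=-1$, $j_0^2=k_0^2=0$, $ij_0=k_0$, $j_0k_0=0$, $k_0i=j_0$, $j_0i=-k_0$, $ik_0=-j_0$, $k_0j_0=0$. Its elements are written $w=x_1+x_2i+x_3j_0+x_4k_0$ with $x_1,x_2,x_3,x_4\in\mathbb{R}$. Open subsets of $\mathbb{H}_0$ are those of the topology induced by the semi-norm $\|w\|_0=\sqrt{x_1^2+x_2^2}$. $\mathcal{F}_{0,U}$ is the set of functions $f:\mathbb{H}_0\to\mathbb{H}_0$ that are $\mathbb{R}$-differentiable on $U$ ($U$ being regarded as an open subset of $\mathbb{R}^4$). A function $f\in\mathcal{F}_{0,U}$ is left $0$-regular on $U$ if $$\nabla_0 f=\frac{\partial f}{\partial x_1}+i\frac{\partial f}{\partial x_2}+j_0\frac{\partial f}{\partial x_3}+k_0\frac{\partial f}{\partial x_4}=0$$ on $U$, and $0$-harmonic on $U$ if $$\varDelta_0 f=\frac{\partial^2f}{\partial x_1^2}+\frac{\partial^2f}{\partial x_2^2}=0$$ on $U$. *)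

theory Defs
  imports "HOL-Analysis.Analysis"
begin

codatatype hyper0 = Hyper0 (cmp1: real) (cmp2: real) (cmp3: real) (cmp4: real)

lemma hyper0_eq_iff:
  "w = v \<longleftrightarrow> cmp1 w = cmp1 v \<and> cmp2 w = cmp2 v \<and> cmp3 w = cmp3 v \<and> cmp4 w = cmp4 v"
  by (auto intro: hyper0.expand)

instantiation hyper0 :: ab_group_add
begin

primcorec zero_hyper0 where
  "cmp1 0 = 0"
| "cmp2 0 = 0"
| "cmp3 0 = 0"
| "cmp4 0 = 0"

primcorec plus_hyper0 where
  "cmp1 (w + v) = cmp1 w + cmp1 v"
| "cmp2 (w + v) = cmp2 w + cmp2 v"
| "cmp3 (w + v) = cmp3 w + cmp3 v"
| "cmp4 (w + v) = cmp4 w + cmp4 v"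

primcorec uminus_hyper0 where
  "cmp1 (- w) = - cmp1 w"
| "cmp2 (- w) = - cmp2 w"
| "cmp3 (- w) = - cmp3 w"
| "cmp4 (- w) = - cmp4 w"

primcorec minus_hyper0 where
  "cmp1 (w - v) = cmp1 w - cmp1 v"
| "cmp2 (w - v) = cmp2 w - cmp2 v"
| "cmp3 (w - v) = cmp3 w - cmp3 v"
| "cmp4 (w - v) = cmp4 w - cmp4 v"

instance
  by standard (simp_all add: hyper0_eq_iff)

end

text \<open>
  The product is the bilinear extension of the multiplication table of the basis
  \<open>1, i, j\<^sub>0, k\<^sub>0\<close>; the lemma \<open>hyper0_mult_table\<close> below recovers the table.
\<close>

instantiation hyper0 :: real_algebra_1
begin

primcorec one_hyper0 where
  "cmp1 1 = 1"
| "cmp2 1 = 0"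
| "cmp3 1 = 0"
| "cmp4 1 = 0"

primcorec times_hyper0 where
  "cmp1 (w * v) = cmp1 w * cmp1 v - cmp2 w * cmp2 v"
| "cmp2 (w * v) = cmp1 w * cmp2 v + cmp2 w * cmp1 v"
| "cmp3 (w * v) = cmp1 w * cmp3 v + cmp3 w * cmp1 v - cmp2 w * cmp4 v + cmp4 w * cmp2 v"
| "cmp4 (w * v) = cmp1 w * cmp4 v + cmp4 w * cmp1 v + cmp2 w * cmp3 v - cmp3 w * cmp2 v"

primcorec scaleR_hyper0 where
  "cmp1 (r *\<^sub>R w) = r * cmp1 w"
| "cmp2 (r *\<^sub>R w) = r * cmp2 w"
| "cmp3 (r *\<^sub>R w) = r * cmp3 w"
| "cmp4 (r *\<^sub>R w) = r * cmp4 w"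

instance
  by standard (simp_all add: hyper0_eq_iff algebra_simps)

end

primcorec h0_i :: hyper0 where
  "cmp1 h0_i = 0"
| "cmp2 h0_i = 1"
| "cmp3 h0_i = 0"
| "cmp4 h0_i = 0"

primcorec h0_j :: hyper0 where
  "cmp1 h0_j = 0"
| "cmp2 h0_j = 0"
| "cmp3 h0_j = 1"
| "cmp4 h0_j = 0"

primcorec h0_k :: hyper0 where
  "cmp1 h0_k = 0"
| "cmp2 h0_k = 0"
| "cmp3 h0_k = 0"
| "cmp4 h0_k = 1"

lemma hyper0_mult_table:
  "h0_i * h0_i = - 1"   "h0_i * h0_j = h0_k"  "h0_i * h0_k = - h0_j"
  "h0_j * h0_i = - h0_k" "h0_j * h0_j = 0"    "h0_j * h0_k = 0"
  "h0_k * h0_i = h0_j"  "h0_k * h0_j = 0"     "h0_k * h0_k = 0"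
  by (simp_all add: hyper0_eq_iff)

lemma hyper0_expansion:
  "w = cmp1 w *\<^sub>R 1 + cmp2 w *\<^sub>R h0_i + cmp3 w *\<^sub>R h0_j + cmp4 w *\<^sub>R h0_k"
  by (simp add: hyper0_eq_iff)

text \<open>
  The type class instances below give \<^typ>\<open>hyper0\<close> the Euclidean structure of
  four-dimensional real space. It is the one underlying real differentiability. In
  particular \<^const>\<open>open\<close> and \<^const>\<open>connected\<close> at this type refer to the Euclidean
  topology, not to the topology of the semi-norm, which is defined separately.
\<close>

instantiation hyper0 :: real_inner
begin

definition inner_hyper0 :: "hyper0 \<Rightarrow> hyper0 \<Rightarrow> real" where
  "inner_hyper0 w v = cmp1 w * cmp1 v + cmp2 w * cmp2 v + cmp3 w * cmp3 v + cmp4 w * cmp4 v"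

definition norm_hyper0 :: "hyper0 \<Rightarrow> real" where
  "norm_hyper0 w = sqrt (inner w w)"

definition sgn_hyper0 :: "hyper0 \<Rightarrow> hyper0" where
  "sgn_hyper0 w = w /\<^sub>R norm w"

definition dist_hyper0 :: "hyper0 \<Rightarrow> hyper0 \<Rightarrow> real" where
  "dist_hyper0 w v = norm (w - v)"

definition uniformity_hyper0 :: "(hyper0 \<times> hyper0) filter" where
  "uniformity_hyper0 = (INF e\<in>{0<..}. principal {(w, v). dist w v < e})"

definition open_hyper0 :: "hyper0 set \<Rightarrow> bool" where
  "open_hyper0 S \<longleftrightarrow> (\<forall>w\<in>S. \<forall>\<^sub>F (w', v) in uniformity. w' = w \<longrightarrow> v \<in> S)"

instance
proof
  fix w v u :: hyper0 and r :: real and S :: "hyper0 set"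
  show "dist w v = norm (w - v)" by (rule dist_hyper0_def)
  show "sgn w = w /\<^sub>R norm w" by (rule sgn_hyper0_def)
  show "uniformity = (INF e\<in>{0<..}. principal {(w :: hyper0, v). dist w v < e})"
    by (rule uniformity_hyper0_def)
  show "open S \<longleftrightarrow> (\<forall>w\<in>S. \<forall>\<^sub>F (w', v) in uniformity. w' = w \<longrightarrow> v \<in> S)"
    by (rule open_hyper0_def)
  show "inner w v = inner v w" by (simp add: inner_hyper0_def mult.commute)
  show "inner (w + v) u = inner w u + inner v u"
    by (simp add: inner_hyper0_def algebra_simps)
  show "inner (r *\<^sub>R w) v = r * inner w v"
    by (simp add: inner_hyper0_def algebra_simps)
  show "0 \<le> inner w w" by (simp add: inner_hyper0_def)
  show "inner w w = 0 \<longleftrightarrow> w = 0"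
    by (simp add: inner_hyper0_def hyper0_eq_iff add_nonneg_eq_0_iff)
  show "norm w = sqrt (inner w w)" by (rule norm_hyper0_def)
qed

end

instantiation hyper0 :: euclidean_space
begin

definition Basis_hyper0 :: "hyper0 set" where
  "Basis_hyper0 = {1, h0_i, h0_j, h0_k}"

instance
proof
  fix u v w :: hyper0
  show "(Basis :: hyper0 set) \<noteq> {}" and "finite (Basis :: hyper0 set)"
    by (simp_all add: Basis_hyper0_def)
  show "u \<in> Basis \<Longrightarrow> v \<in> Basis \<Longrightarrow> inner u v = (if u = v then 1 else 0)"
    unfolding Basis_hyper0_def inner_hyper0_def hyper0_eq_iff[of u v]
    by (elim insertE emptyE) simp_all
  show "(\<forall>u\<in>Basis. inner w u = 0) \<longleftrightarrow> w = 0"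
    by (simp add: Basis_hyper0_def inner_hyper0_def hyper0_eq_iff[of w 0])
qed

end

definition norm0 :: "hyper0 \<Rightarrow> real" where
  "norm0 w = sqrt ((cmp1 w)\<^sup>2 + (cmp2 w)\<^sup>2)"

lemma norm0_triangle: "norm0 (w + v) \<le> norm0 w + norm0 v"
  unfolding norm0_def plus_hyper0.sel by (rule real_sqrt_sum_squares_triangle_ineq)

definition h0_topology :: "hyper0 topology" where
  "h0_topology = topology (\<lambda>S. \<forall>w\<in>S. \<exists>e>0. \<forall>v. norm0 (v - w) < e \<longrightarrow> v \<in> S)"

lemma openin_h0_topology:
  "openin h0_topology S \<longleftrightarrow> (\<forall>w\<in>S. \<exists>e>0. \<forall>v. norm0 (v - w) < e \<longrightarrow> v \<in> S)"
proof -
  have "istopology (\<lambda>S. \<forall>w\<in>S. \<exists>e>0. \<forall>v. norm0 (v - w) < e \<longrightarrow> v \<in> S)"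
    unfolding istopology_def
  proof (intro conjI allI impI ballI)
    fix S T w
    assume S: "\<forall>w\<in>S. \<exists>e>0. \<forall>v. norm0 (v - w) < e \<longrightarrow> v \<in> S"
      and T: "\<forall>w\<in>T. \<exists>e>0. \<forall>v. norm0 (v - w) < e \<longrightarrow> v \<in> T" and w: "w \<in> S \<inter> T"
    obtain d e where "d > 0" "\<forall>v. norm0 (v - w) < d \<longrightarrow> v \<in> S"
      and "e > 0" "\<forall>v. norm0 (v - w) < e \<longrightarrow> v \<in> T"
      using S T w by blast
    then show "\<exists>e>0. \<forall>v. norm0 (v - w) < e \<longrightarrow> v \<in> S \<inter> T"
      by (intro exI[of _ "min d e"]) simp
  next
    fix \<K> w
    assume K: "\<forall>S\<in>\<K>. \<forall>w\<in>S. \<exists>e>0. \<forall>v. norm0 (v - w) < e \<longrightarrow> v \<in> S"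
      and "w \<in> \<Union>\<K>"
    then obtain S where "S \<in> \<K>" "w \<in> S" by blast
    moreover from this K obtain e where "e > 0" "\<forall>v. norm0 (v - w) < e \<longrightarrow> v \<in> S" by blast
    ultimately show "\<exists>e>0. \<forall>v. norm0 (v - w) < e \<longrightarrow> v \<in> \<Union>\<K>" by blast
  qed
  then show ?thesis
    by (simp add: h0_topology_def)
qed

lemma topspace_h0_topology [simp]: "topspace h0_topology = UNIV"
proof -
  have "openin h0_topology UNIV"
    unfolding openin_h0_topology by (auto intro: exI[of _ 1])
  then show ?thesis
    using openin_subset by blast
qed

text \<open>
  A set that is open for the semi-norm is also open for the Euclidean norm, so on such a
  set \<^const>\<open>differentiable_on\<close> means Frechet differentiability at every point.
\<close>

lemma openin_h0_topology_imp_open: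
  assumes "openin h0_topology U"
  shows "open U"
proof (unfold open_dist, intro ballI)
  fix w assume "w \<in> U"
  then obtain e where e: "e > 0" "\<forall>v. norm0 (v - w) < e \<longrightarrow> v \<in> U"
    using assms openin_h0_topology by blast
  have "norm0 u \<le> norm u" for u
    by (simp add: norm0_def norm_hyper0_def inner_hyper0_def power2_eq_square)
  then show "\<exists>e>0. \<forall>v. dist v w < e \<longrightarrow> v \<in> U"
    using e by (intro exI[of _ e]) (auto simp: dist_norm intro: le_less_trans)
qed

definition F0 :: "hyper0 set \<Rightarrow> (hyper0 \<Rightarrow> hyper0) set" where
  "F0 U = {f. f differentiable_on U}"

definition partial_differentiable :: "hyper0 \<Rightarrow> (hyper0 \<Rightarrow> hyper0) \<Rightarrow> hyper0 \<Rightarrow> bool" where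
  "partial_differentiable b f w \<longleftrightarrow> (\<lambda>t::real. f (w + t *\<^sub>R b)) differentiable (at 0)"

definition partial :: "hyper0 \<Rightarrow> (hyper0 \<Rightarrow> hyper0) \<Rightarrow> hyper0 \<Rightarrow> hyper0" where
  "partial b f w = vector_derivative (\<lambda>t. f (w + t *\<^sub>R b)) (at 0)"

definition nabla0 :: "(hyper0 \<Rightarrow> hyper0) \<Rightarrow> hyper0 \<Rightarrow> hyper0" where
  "nabla0 f w =
     partial 1 f w + h0_i * partial h0_i f w + h0_j * partial h0_j f w + h0_k * partial h0_k f w"

definition Delta0 :: "(hyper0 \<Rightarrow> hyper0) \<Rightarrow> hyper0 \<Rightarrow> hyper0" where
  "Delta0 f w = partial 1 (partial 1 f) w + partial h0_i (partial h0_i f) w"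

definition left_regular0 :: "hyper0 set \<Rightarrow> (hyper0 \<Rightarrow> hyper0) \<Rightarrow> bool" where
  "left_regular0 U f \<longleftrightarrow> f \<in> F0 U \<and> (\<forall>w\<in>U. nabla0 f w = 0)"

text \<open>
  The first-order partial derivatives of a member of \<^term>\<open>F0 U\<close> exist on \<open>U\<close>. The two
  second-order ones need not, and \<^const>\<open>vector_derivative\<close> is total, so harmonicity
  explicitly includes their existence.
\<close>

definition harmonic0 :: "hyper0 set \<Rightarrow> (hyper0 \<Rightarrow> hyper0) \<Rightarrow> bool" where
  "harmonic0 U f \<longleftrightarrow> f \<in> F0 U \<and>
     (\<forall>w\<in>U. partial_differentiable 1 (partial 1 f) w \<and>
            partial_differentiable h0_i (partial h0_i f) w \<and>
            Delta0 f w = 0)"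

end

theory Submission
  imports Defs "HOL-Complex_Analysis.Complex_Analysis"
begin

text \<open>
  If \<open>f\<close> were of class \<open>C\<^sup>2\<close>, one could apply
  \<open>\<partial>\<^sub>1 - i \<partial>\<^sub>2 - j\<^sub>0 \<partial>\<^sub>3 - k\<^sub>0 \<partial>\<^sub>4\<close>, whose product with \<open>\<nabla>\<^sub>0\<close> is the Laplacian
  \<open>\<partial>\<^sub>1\<^sup>2 + \<partial>\<^sub>2\<^sup>2\<close>. A function that is merely differentiable is first smoothed: as in Goursat's
  proof, repeated bisection shows that the flux belonging to \<open>\<nabla>\<^sub>0\<close> through every small cube
  vanishes, so integrating \<open>f\<close> twice over cubes of side \<open>h\<close> gives a \<open>C\<^sup>2\<close> function to which the
  computation applies. On discs parallel to the \<open>(x\<^sub>1, x\<^sub>2)\<close>-plane the components of the smoothed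
  function are therefore real parts of holomorphic functions, and by Montel's theorem this
  survives the limit \<open>h \<longrightarrow> 0\<close>. In particular the second partial derivatives of \<open>f\<close> exist.
\<close>

section \<open>Integrals over translated boxes\<close>

text \<open>The constructions on boxes are operators on functions of the corner \<open>w\<close>
  rather than integrals over a fixed set. The box then moves with \<open>w\<close>, and averaging,
  differencing and subdividing become compositions of operators that commute.\<close>

definition segint :: "real \<Rightarrow> 'a::real_normed_vector \<Rightarrow> ('a \<Rightarrow> 'b::banach) \<Rightarrow> 'a \<Rightarrow> 'b" where
  "segint h b u w = integral {0..h} (\<lambda>t. u (w + t *\<^sub>R b))"

definition fdiff :: "real \<Rightarrow> 'a::real_normed_vector \<Rightarrow> ('a \<Rightarrow> 'b::banach) \<Rightarrow> 'a \<Rightarrow> 'b" where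
  "fdiff h b u w = u (w + h *\<^sub>R b) - u w"

definition fsum :: "real \<Rightarrow> 'a::real_normed_vector \<Rightarrow> ('a \<Rightarrow> 'b::banach) \<Rightarrow> 'a \<Rightarrow> 'b" where
  "fsum h b u w = u w + u (w + h *\<^sub>R b)"

definition box_int :: "real \<Rightarrow> 'a::real_normed_vector list \<Rightarrow> ('a \<Rightarrow> 'b::banach) \<Rightarrow> 'a \<Rightarrow> 'b" where
  "box_int h bs = foldr (segint h) bs"

text \<open>The points summed over are the vertices of the box of side \<open>h\<close> at
  \<open>w\<close>. They are also the corners of the subboxes that arise by bisecting the box of
  side \<open>2 * h\<close> at \<open>w\<close>.\<close>

definition vertex_sum :: "real \<Rightarrow> 'a::real_normed_vector list \<Rightarrow> ('a \<Rightarrow> 'b::banach) \<Rightarrow> 'a \<Rightarrow> 'b" where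
  "vertex_sum h bs = foldr (fsum h) bs"

text \<open>Two opposite faces of the box enter, those orthogonal to \<open>b\<close> when the edges
  are orthogonal. Weighted sums of these differences over \<open>b\<close> form the flux.\<close>

definition face_diff :: "real \<Rightarrow> 'a::real_normed_vector list \<Rightarrow> 'a \<Rightarrow> ('a \<Rightarrow> 'b::banach) \<Rightarrow> 'a \<Rightarrow> 'b" where
  "face_diff h bs b u = box_int h (remove1 b bs) (fdiff h b u)"

section \<open>Integrals along segments\<close>

lemma integrable_segint:
  fixes u :: "'a::real_normed_vector \<Rightarrow> 'b::banach"
  assumes "continuous_on UNIV u"
  shows "(\<lambda>t. u (w + t *\<^sub>R b)) integrable_on {c..d}"
  by (intro integrable_continuous_real continuous_on_compose2[OF assms] continuous_intros) auto

lemma continuous_segint: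
  fixes u :: "'a::real_normed_vector \<Rightarrow> 'b::banach"
  assumes "continuous_on UNIV u"
  shows "continuous_on UNIV (segint h b u)"
  unfolding segint_def[abs_def] cbox_interval[symmetric]
  by (intro integral_continuous_on_param)
     (auto simp: case_prod_unfold intro!: continuous_on_compose2[OF assms] continuous_intros)

lemma segint_commute:
  fixes u :: "'a::real_normed_vector \<Rightarrow> 'b::banach"
  assumes "continuous_on UNIV u"
  shows "segint h b (segint k c u) = segint k c (segint h b u)"
proof
  fix w
  have "integral (cbox 0 h) (\<lambda>s. integral (cbox 0 k) (\<lambda>t. u (w + s *\<^sub>R b + t *\<^sub>R c)))
      = integral (cbox 0 k) (\<lambda>t. integral (cbox 0 h) (\<lambda>s. u (w + s *\<^sub>R b + t *\<^sub>R c)))"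
    by (intro integral_swap_continuous)
       (auto simp: case_prod_unfold intro!: continuous_on_compose2[OF assms] continuous_intros)
  then show "segint h b (segint k c u) w = segint k c (segint h b u) w"
    by (simp add: segint_def algebra_simps)
qed

lemma segint_linear:
  fixes u :: "'a::real_normed_vector \<Rightarrow> 'b::banach"
  assumes "continuous_on UNIV u" "bounded_linear L"
  shows "segint h b (\<lambda>w. L (u w)) = (\<lambda>w. L (segint h b u w))"
  using integral_linear[OF integrable_segint[OF assms(1)] assms(2)]
  by (auto simp: segint_def o_def)

lemma segint_add:
  fixes u v :: "'a::real_normed_vector \<Rightarrow> 'b::banach"
  assumes "continuous_on UNIV u" "continuous_on UNIV v"
  shows "segint h b (\<lambda>w. u w + v w) = (\<lambda>w. segint h b u w + segint h b v w)"
  by (rule ext) (simp add: segint_def integral_add integrable_segint assms)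

text \<open>By the fundamental theorem of calculus, moving a segment along its own direction changes
  the integral only at its two ends.\<close>

lemma segint_vector_derivative:
  fixes u :: "'a::real_normed_vector \<Rightarrow> 'b::banach"
  assumes u: "continuous_on UNIV u" and h: "h \<ge> 0"
  shows "((\<lambda>t. segint h b u (w + t *\<^sub>R b)) has_vector_derivative fdiff h b u (w + x *\<^sub>R b)) (at x)"
proof -
  define g where "g = (\<lambda>s. u (w + s *\<^sub>R b))"
  \<comment> \<open>The base point \<open>x - 1\<close> makes \<open>G\<close> a primitive of
    \<open>g\<close> on a two-sided neighbourhood of \<open>x\<close>.\<close>
  define G where "G = (\<lambda>s. integral {x - 1..s} g)"
  have g: "continuous_on UNIV g"
    unfolding g_def by (intro continuous_on_compose2[OF u] continuous_intros) auto
  have gi: "g integrable_on {c..d}" for c d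
    using continuous_on_subset[OF g] by (intro integrable_continuous_real) auto
  have G: "(G has_vector_derivative g s) (at s)" if "x - 1 < s" for s
  proof -
    have "(G has_vector_derivative g s) (at s within {x - 1..s + 1})"
      unfolding G_def
      by (rule integral_has_vector_derivative) (use that continuous_on_subset[OF g] in auto)
    then show ?thesis
      using that by (simp add: at_within_Icc_at)
  qed
  have eq: "segint h b u (w + t *\<^sub>R b) = G (t + h) - G t" if "x - 1 < t" for t
  proof -
    have "segint h b u (w + t *\<^sub>R b) = integral {t - t..t + h - t} (\<lambda>s. g (s + t))"
      by (simp add: segint_def g_def algebra_simps)
    also have "\<dots> = integral {t..t + h} g" by (rule integral_shift_real_ivl)
    also have "\<dots> = G (t + h) - G t"
      using Henstock_Kurzweil_Integration.integral_combine[OF _ _ gi, of "x - 1" t "t + h"] that h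
      by (simp add: G_def algebra_simps)
    finally show ?thesis .
  qed
  have "((\<lambda>t. G (t + h)) has_vector_derivative g (x + h)) (at x)"
    using vector_diff_chain_at[of "\<lambda>t. t + h" 1 x G "g (x + h)"] G[of "x + h"] h
    by (simp add: o_def has_vector_derivative_add_const flip: has_real_derivative_iff_has_vector_derivative)
  then have "((\<lambda>t. G (t + h) - G t) has_vector_derivative g (x + h) - g x) (at x)"
    by (intro has_vector_derivative_diff G) auto
  moreover have "g (x + h) - g x = fdiff h b u (w + x *\<^sub>R b)"
    by (simp add: g_def fdiff_def algebra_simps)
  ultimately show ?thesis
    using has_vector_derivative_transform_within_open[of "\<lambda>t. G (t + h) - G t" _ x "{x - 1<..}"] eq
    by auto
qed

lemma segint_double:
  fixes u :: "'a::real_normed_vector \<Rightarrow> 'b::banach"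
  assumes u: "continuous_on UNIV u" and h: "h \<ge> 0"
  shows "segint (2 * h) b u = fsum h b (segint h b u)"
proof
  fix w
  have "integral {0..h} (\<lambda>s. u (w + s *\<^sub>R b)) + integral {h..2 * h} (\<lambda>s. u (w + s *\<^sub>R b))
        = integral {0..2 * h} (\<lambda>s. u (w + s *\<^sub>R b))"
    by (rule Henstock_Kurzweil_Integration.integral_combine[OF _ _ integrable_segint[OF u]]) (use h in auto)
  moreover have "integral {h - h..2 * h - h} (\<lambda>s. u (w + (s + h) *\<^sub>R b)) = integral {h..2 * h} (\<lambda>s. u (w + s *\<^sub>R b))"
    by (rule integral_shift_real_ivl)
  ultimately show "segint (2 * h) b u w = fsum h b (segint h b u) w"
    by (simp add: segint_def fsum_def algebra_simps)
qed

lemma fdiff_double: "fdiff (2 * h) b u = fsum h b (fdiff h b u)"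
  by (rule ext) (simp add: fdiff_def fsum_def scaleR_2 algebra_simps flip: scaleR_scaleR)

lemma segint_bound:
  fixes u :: "'a::real_normed_vector \<Rightarrow> 'b::banach"
  assumes u: "continuous_on UNIV u" and h: "h \<ge> 0" and b: "norm b \<le> 1"
    and B: "\<And>x. x \<in> cball w (R + h) \<Longrightarrow> norm (u x) \<le> B" and x: "x \<in> cball w R"
  shows "norm (segint h b u x) \<le> h * B"
proof -
  have "norm (integral {0..h} (\<lambda>t. u (x + t *\<^sub>R b))) \<le> B * (h - 0)"
  proof (rule integral_bound)
    show "norm (u (x + t *\<^sub>R b)) \<le> B" if "t \<in> {0..h}" for t
    proof (rule B)
      have "dist w (x + t *\<^sub>R b) \<le> dist w x + norm (t *\<^sub>R b)"
        using dist_triangle[of w "x + t *\<^sub>R b" x] by (simp add: dist_norm)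
      also have "norm (t *\<^sub>R b) \<le> h * 1"
        using that b unfolding norm_scaleR by (intro mult_mono) auto
      finally show "x + t *\<^sub>R b \<in> cball w (R + h)" using x by auto
    qed
  qed (use h in \<open>auto intro!: continuous_on_compose2[OF u] continuous_intros\<close>)
  then show ?thesis by (simp add: segint_def mult.commute)
qed

text \<open>
  The closure properties needed for integrals, differences and sums over boxes to commute
  with one another.
\<close>

definition averaging_op :: "(('a::real_normed_vector \<Rightarrow> 'b::banach) \<Rightarrow> 'a \<Rightarrow> 'b) \<Rightarrow> bool" where
  "averaging_op T \<longleftrightarrow>
    (\<forall>u. continuous_on UNIV u \<longrightarrow> continuous_on UNIV (T u)) \<and>
    (\<forall>u v. continuous_on UNIV u \<longrightarrow> continuous_on UNIV v \<longrightarrow>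
      T (\<lambda>w. u w + v w) = (\<lambda>w. T u w + T v w)) \<and>
    (\<forall>u L. continuous_on UNIV u \<longrightarrow> bounded_linear L \<longrightarrow> T (\<lambda>w. L (u w)) = (\<lambda>w. L (T u w))) \<and>
    (\<forall>u x. continuous_on UNIV u \<longrightarrow> T (\<lambda>w. u (w + x)) = (\<lambda>w. T u (w + x))) \<and>
    (\<forall>u h b. continuous_on UNIV u \<longrightarrow> T (segint h b u) = segint h b (T u))"

lemma
  assumes "averaging_op T" "continuous_on UNIV u"
  shows averaging_op_continuous: "continuous_on UNIV (T u)"
    and averaging_op_add: "continuous_on UNIV v \<Longrightarrow> T (\<lambda>w. u w + v w) = (\<lambda>w. T u w + T v w)"
    and averaging_op_linear: "bounded_linear L \<Longrightarrow> T (\<lambda>w. L (u w)) = (\<lambda>w. L (T u w))"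
    and averaging_op_shift: "T (\<lambda>w. u (w + x)) = (\<lambda>w. T u (w + x))"
    and averaging_op_segint: "T (segint h b u) = segint h b (T u)"
  using assms unfolding averaging_op_def by blast+

lemma averaging_op_diff:
  assumes T: "averaging_op T" and u: "continuous_on UNIV u" and v: "continuous_on UNIV v"
  shows "T (\<lambda>w. u w - v w) = (\<lambda>w. T u w - T v w)"
proof -
  have "continuous_on UNIV (\<lambda>w. - v w)" using v by (intro continuous_intros)
  from averaging_op_add[OF T u this] averaging_op_linear[OF T v bounded_linear_minus[OF bounded_linear_ident]]
  show ?thesis by simp
qed

lemma continuous_shift:
  fixes u :: "'a::real_normed_vector \<Rightarrow> 'b::banach"
  assumes "continuous_on UNIV u" shows "continuous_on UNIV (\<lambda>w. u (w + x))"
  by (intro continuous_on_compose2[OF assms] continuous_intros) auto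

lemma averaging_op_fdiff:
  assumes T: "averaging_op T" and u: "continuous_on UNIV u"
  shows "T (fdiff h b u) = fdiff h b (T u)"
  using averaging_op_diff[OF T continuous_shift[OF u, of "h *\<^sub>R b"] u] averaging_op_shift[OF T u]
  by (simp add: fdiff_def[abs_def])

lemma averaging_op_fsum:
  assumes T: "averaging_op T" and u: "continuous_on UNIV u"
  shows "T (fsum h b u) = fsum h b (T u)"
  using averaging_op_add[OF T u continuous_shift[OF u, of "h *\<^sub>R b"]] averaging_op_shift[OF T u]
  by (simp add: fsum_def[abs_def])

lemma averaging_op_comp:
  assumes "averaging_op S" "averaging_op T"
  shows "averaging_op (\<lambda>u. S (T u))"
  unfolding averaging_op_def
  by (intro allI impI conjI)
     (simp_all add: averaging_op_continuous averaging_op_add averaging_op_linear averaging_op_shift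
       averaging_op_segint assms)

lemma averaging_op_id: "averaging_op (\<lambda>u. u)"
  by (simp add: averaging_op_def)

lemma averaging_op_segint_self: "averaging_op (segint h b)"
  unfolding averaging_op_def
  by (intro allI impI conjI continuous_segint segint_add segint_linear segint_commute)
     (auto simp: segint_def algebra_simps)

lemma averaging_op_fdiff_self: "averaging_op (fdiff h b)"
  unfolding averaging_op_def
proof (intro allI impI conjI)
  show "continuous_on UNIV (fdiff h b u)" if "continuous_on UNIV u" for u :: "'a \<Rightarrow> 'b"
    unfolding fdiff_def[abs_def] by (intro continuous_on_diff continuous_shift that)
qed (auto simp: fdiff_def[abs_def] algebra_simps linear_diff[OF bounded_linear.linear]
    averaging_op_diff[OF averaging_op_segint_self] averaging_op_shift[OF averaging_op_segint_self]
    continuous_shift)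

lemma averaging_op_fsum_self: "averaging_op (fsum h b)"
  unfolding averaging_op_def
proof (intro allI impI conjI)
  show "continuous_on UNIV (fsum h b u)" if "continuous_on UNIV u" for u :: "'a \<Rightarrow> 'b"
    unfolding fsum_def[abs_def] by (intro continuous_on_add continuous_shift that)
qed (auto simp: fsum_def[abs_def] algebra_simps linear_add[OF bounded_linear.linear]
    averaging_op_add[OF averaging_op_segint_self] averaging_op_shift[OF averaging_op_segint_self]
    continuous_shift)

section \<open>Boxes, their faces and their bisection\<close>

lemma averaging_op_box_int: "averaging_op (box_int h bs)"
  by (induction bs)
     (simp_all add: box_int_def averaging_op_id id_def o_def
        averaging_op_comp[OF averaging_op_segint_self])

lemma averaging_op_vertex_sum: "averaging_op (vertex_sum h bs)"
  by (induction bs)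
     (simp_all add: vertex_sum_def averaging_op_id id_def o_def
        averaging_op_comp[OF averaging_op_fsum_self])

lemma averaging_op_face_diff: "averaging_op (face_diff h bs b)"
  using averaging_op_comp[OF averaging_op_box_int averaging_op_fdiff_self]
  by (simp add: face_diff_def[abs_def])

lemma averaging_op_box_int_commute:
  assumes T: "averaging_op T" and u: "continuous_on UNIV u"
  shows "T (box_int h bs u) = box_int h bs (T u)"
  by (induction bs)
     (simp_all add: box_int_def averaging_op_segint[OF T averaging_op_continuous[OF averaging_op_box_int u, unfolded box_int_def]])

lemma averaging_op_face_diff_commute:
  assumes T: "averaging_op T" and u: "continuous_on UNIV u"
  shows "T (face_diff h bs b u) = face_diff h bs b (T u)"
  by (simp add: face_diff_def averaging_op_box_int_commute[OF T] averaging_op_fdiff[OF T] u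
      averaging_op_continuous[OF averaging_op_fdiff_self])

text \<open>By Fubini the integration along \<open>b\<close> may be performed last, where the
  fundamental theorem of calculus applies to it.\<close>

lemma box_int_remove1:
  assumes u: "continuous_on UNIV u" and "b \<in> set bs"
  shows "box_int h bs u = segint h b (box_int h (remove1 b bs) u)"
  using assms(2)
proof (induction bs)
  case (Cons c bs)
  show ?case
  proof (cases "b = c")
    case False
    then have "box_int h (c # bs) u = segint h c (segint h b (box_int h (remove1 b bs) u))"
      using Cons by (simp add: box_int_def)
    also have "\<dots> = segint h b (segint h c (box_int h (remove1 b bs) u))"
      by (intro segint_commute averaging_op_continuous[OF averaging_op_box_int u])
    finally show ?thesis using False by (simp add: box_int_def)
  qed (simp add: box_int_def)
qed simp

text \<open>This is the gain from smoothing: integration over boxes turns a continuous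
  \<open>u\<close> into a function with continuous derivatives along the edges.\<close>

lemma box_int_vector_derivative:
  assumes u: "continuous_on UNIV u" and h: "h \<ge> 0" and b: "b \<in> set bs"
  shows "((\<lambda>t. box_int h bs u (w + t *\<^sub>R b)) has_vector_derivative
           face_diff h bs b u (w + x *\<^sub>R b)) (at x)"
  unfolding box_int_remove1[OF u b] face_diff_def averaging_op_fdiff[OF averaging_op_box_int u]
  by (intro segint_vector_derivative averaging_op_continuous[OF averaging_op_box_int u] h)

lemma vertex_sum_remove1:
  assumes "b \<in> set bs"
  shows "vertex_sum h bs u = vertex_sum h (remove1 b bs) (fsum h b u)"
  using assms
proof (induction bs)
  case (Cons c bs)
  show ?case
  proof (cases "b = c")
    case True
    have "fsum h b (vertex_sum h bs u) = vertex_sum h bs (fsum h b u)" for bs :: "'a list" and u :: "'a \<Rightarrow> 'b"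
    proof (induction bs)
      case (Cons d ds)
      have "fsum h b (fsum h d v) = fsum h d (fsum h b v)" for v :: "'a \<Rightarrow> 'b"
        by (rule ext) (simp add: fsum_def algebra_simps)
      then show ?case using Cons by (simp add: vertex_sum_def[abs_def])
    qed (simp add: vertex_sum_def)
    then show ?thesis using True by (simp add: vertex_sum_def)
  next
    case False
    then show ?thesis using Cons by (simp add: vertex_sum_def)
  qed
qed simp

text \<open>Every edge splits into two halves, which cuts the box into the subboxes at the
  vertices.\<close>

lemma box_int_double:
  assumes u: "continuous_on UNIV u" and h: "h \<ge> 0"
  shows "box_int (2 * h) bs u = vertex_sum h bs (box_int h bs u)"
proof (induction bs)
  case (Cons b bs)
  have c: "continuous_on UNIV (box_int h bs u)"
    by (rule averaging_op_continuous[OF averaging_op_box_int u])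
  have "box_int (2 * h) (b # bs) u = segint (2 * h) b (vertex_sum h bs (box_int h bs u))"
    using Cons by (simp add: box_int_def)
  also have "\<dots> = fsum h b (segint h b (vertex_sum h bs (box_int h bs u)))"
    by (intro segint_double h averaging_op_continuous[OF averaging_op_vertex_sum c])
  also have "segint h b (vertex_sum h bs (box_int h bs u)) = vertex_sum h bs (segint h b (box_int h bs u))"
    by (rule averaging_op_segint[OF averaging_op_vertex_sum c, symmetric])
  finally show ?case by (simp add: box_int_def vertex_sum_def)
qed (simp add: box_int_def vertex_sum_def)

text \<open>Along \<open>b\<close> the two contributions of an inner face cancel, by
  \<open>fdiff_double\<close>; along the other edges the faces are cut into halves. This additivity
  is what makes bisection of the flux possible.\<close>

lemma face_diff_double:
  assumes u: "continuous_on UNIV u" and h: "h \<ge> 0" and b: "b \<in> set bs"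
  shows "face_diff (2 * h) bs b u = vertex_sum h bs (face_diff h bs b u)"
proof -
  have c: "continuous_on UNIV (fdiff h b u)"
    by (rule averaging_op_continuous[OF averaging_op_fdiff_self u])
  have "face_diff (2 * h) bs b u
      = vertex_sum h (remove1 b bs) (box_int h (remove1 b bs) (fsum h b (fdiff h b u)))"
    unfolding face_diff_def fdiff_double
    by (intro box_int_double h averaging_op_continuous[OF averaging_op_fsum_self c])
  also have "box_int h (remove1 b bs) (fsum h b (fdiff h b u)) = fsum h b (face_diff h bs b u)"
    unfolding face_diff_def by (intro averaging_op_fsum averaging_op_box_int c)
  also have "vertex_sum h (remove1 b bs) \<dots> = vertex_sum h bs (face_diff h bs b u)"
    by (rule vertex_sum_remove1[OF b, symmetric])
  finally show ?thesis .
qed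

section \<open>Size estimates\<close>

lemma vertex_sum_bound:
  assumes "h \<ge> 0" "\<And>b. b \<in> set bs \<Longrightarrow> norm b \<le> 1"
    and "\<And>x. x \<in> cball w (real (length bs) * h) \<Longrightarrow> norm (v x) < c"
  shows "norm (vertex_sum h bs v w) < 2 ^ length bs * c"
  using assms(2,3)
proof (induction bs arbitrary: w)
  case (Cons b bs)
  have b: "norm (h *\<^sub>R b) \<le> h"
    using Cons.prems(1)[of b] assms(1) by (simp add: mult_left_le)
  have "norm (vertex_sum h bs v y) < 2 ^ length bs * c" if "y = w \<or> y = w + h *\<^sub>R b" for y
  proof (rule Cons.IH)
    fix x assume "x \<in> cball y (real (length bs) * h)"
    moreover have "dist w x \<le> dist w y + dist y x" by (rule dist_triangle)
    moreover have "dist w y \<le> h" using that b assms(1) by (auto simp: dist_norm)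
    ultimately show "norm (v x) < c"
      by (intro Cons.prems(2)) (simp add: algebra_simps)
  qed (use Cons.prems in auto)
  from this[of w] this[of "w + h *\<^sub>R b"] show ?case
    using norm_triangle_ineq[of "vertex_sum h bs v w" "vertex_sum h bs v (w + h *\<^sub>R b)"]
    by (simp add: vertex_sum_def fsum_def)
qed (simp add: vertex_sum_def)

text \<open>Each integration contributes a factor \<open>h\<close> and enlarges the ball by
  \<open>h\<close>; the induction therefore needs an arbitrary radius \<open>R\<close>.\<close>

lemma box_int_bound:
  assumes u: "continuous_on UNIV u" and h: "h \<ge> 0" and "\<And>b. b \<in> set bs \<Longrightarrow> norm b \<le> 1"
    and "\<And>x. x \<in> cball w (R + real (length bs) * h) \<Longrightarrow> norm (u x) \<le> B" and "x \<in> cball w R"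
  shows "norm (box_int h bs u x) \<le> h ^ length bs * B"
  using assms(3-)
proof (induction bs arbitrary: R x)
  case Nil
  then show ?case by (simp add: box_int_def)
next
  case (Cons b bs)
  have "norm (segint h b (box_int h bs u) x) \<le> h * (h ^ length bs * B)"
    by (rule segint_bound[where w = w and R = R]; (rule Cons.IH[where R = "R + h"])?)
       (use Cons.prems in \<open>auto simp: h algebra_simps averaging_op_continuous[OF averaging_op_box_int u]\<close>)
  then show ?case by (simp add: box_int_def mult.assoc)
qed

lemma box_int_const: "h \<ge> 0 \<Longrightarrow> box_int h bs (\<lambda>_. c) = (\<lambda>_. h ^ length bs *\<^sub>R c)"
proof (induction bs)
  case (Cons b bs)
  then show ?case by (auto simp: box_int_def segint_def)
qed (simp add: box_int_def)

text \<open>A face has one dimension less than the box, and the 2 counts the two faces. A function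
  of size \<open>e * h\<close> thus contributes only of order
  \<open>e * h ^ length bs\<close>.\<close>

lemma face_diff_bound:
  assumes u: "continuous_on UNIV u" and h: "h \<ge> 0" and bs: "\<And>b. b \<in> set bs \<Longrightarrow> norm b \<le> 1"
    and b: "b \<in> set bs" and B: "\<And>x. x \<in> cball w (real (length bs) * h) \<Longrightarrow> norm (u x) \<le> B"
  shows "norm (face_diff h bs b u w) \<le> h ^ (length bs - 1) * (2 * B)"
proof -
  have l: "length (remove1 b bs) = length bs - 1" "length bs > 0"
    using b by (auto simp: length_remove1)
  have "norm (box_int h (remove1 b bs) (fdiff h b u) w) \<le> h ^ length (remove1 b bs) * (2 * B)"
  proof (rule box_int_bound[where w = w and R = 0])
    fix x assume "x \<in> cball w (0 + real (length (remove1 b bs)) * h)"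
    then have d: "dist w x \<le> real (length bs) * h - h"
      using l by (auto simp: of_nat_diff algebra_simps)
    have "norm (h *\<^sub>R b) \<le> h" using bs[OF b] h by (simp add: mult_left_le)
    then have "dist w (x + h *\<^sub>R b) \<le> real (length bs) * h"
      using d dist_triangle[of w "x + h *\<^sub>R b" x] by (simp add: dist_norm)
    then show "norm (fdiff h b u x) \<le> 2 * B"
      using B[of x] B[of "x + h *\<^sub>R b"] d h norm_triangle_ineq4[of "u (x + h *\<^sub>R b)" "u x"]
      by (simp add: fdiff_def)
  next
    show "norm c \<le> 1" if "c \<in> set (remove1 b bs)" for c
      using bs that by (meson notin_set_remove1)
  qed (simp_all add: h averaging_op_continuous[OF averaging_op_fdiff_self u])
  then show ?thesis by (simp add: face_diff_def l)
qed

text \<open>Between opposite faces an affine function changes by the constant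
  \<open>h *\<^sub>R L b\<close>; integration over the face supplies the other powers of
  \<open>h\<close>.\<close>

lemma face_diff_affine:
  assumes "bounded_linear L" "h \<ge> 0" "b \<in> set bs"
  shows "face_diff h bs b (\<lambda>x. c + L (x - a)) = (\<lambda>_. h ^ length bs *\<^sub>R L b)"
proof -
  interpret bounded_linear L by fact
  have l: "length bs = Suc (length (remove1 b bs))"
    using assms(3) by (auto simp: length_remove1 dest: length_pos_if_in_set)
  have "fdiff h b (\<lambda>x. c + L (x - a)) = (\<lambda>_. h *\<^sub>R L b)"
    by (rule ext) (simp add: fdiff_def add diff scaleR)
  then show ?thesis
    by (simp add: face_diff_def box_int_const assms(2) l mult.commute)
qed

section \<open>Flux through cubes\<close>

lemma averaging_op_sum:
  assumes T: "averaging_op T" and "finite S" and "\<And>b. b \<in> S \<Longrightarrow> continuous_on UNIV (v b)"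
    and "\<And>b. b \<in> S \<Longrightarrow> bounded_linear (C b)"
  shows "T (\<lambda>w. \<Sum>b\<in>S. C b (v b w)) = (\<lambda>w. \<Sum>b\<in>S. C b (T (v b) w))"
  using assms(2-)
proof (induction S rule: finite_induct)
  case empty
  have "continuous_on UNIV (\<lambda>_. 0)" by simp
  from averaging_op_linear[OF T this bounded_linear_zero] show ?case by simp
next
  case (insert b S)
  have c: "continuous_on UNIV (\<lambda>w. C c (v c w))" if "c \<in> insert b S" for c
    by (rule bounded_linear.continuous_on[of "C c"]) (use insert.prems that in auto)
  have "T (\<lambda>w. C b (v b w) + (\<Sum>b\<in>S. C b (v b w)))
      = (\<lambda>w. T (\<lambda>w. C b (v b w)) w + T (\<lambda>w. \<Sum>b\<in>S. C b (v b w)) w)"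
    by (intro averaging_op_add[OF T] continuous_on_sum c) auto
  also have "T (\<lambda>w. C b (v b w)) = (\<lambda>w. C b (T (v b) w))"
    by (intro averaging_op_linear[OF T]) (auto simp: insert.prems)
  also have "T (\<lambda>w. \<Sum>b\<in>S. C b (v b w)) = (\<lambda>w. \<Sum>b\<in>S. C b (T (v b) w))"
    using insert by simp
  finally show ?case using insert by simp
qed

text \<open>Goursat's argument. A nonzero flux would yield shrinking boxes whose flux stays at least
  a fixed multiple of \<open>H m ^ n\<close>. At their limit point the affine approximation of
  \<open>u\<close> has zero flux by the differential equation, and the flux of the remainder is of
  smaller order.\<close>

proposition box_flux_eq_0:
  fixes u :: "'a::euclidean_space \<Rightarrow> 'b::banach" and C :: "'a \<Rightarrow> 'b \<Rightarrow> 'b" and h :: real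
  assumes u: "continuous_on UNIV u" and h: "h > 0"
    and bs: "\<And>b. b \<in> set bs \<Longrightarrow> norm b \<le> 1" and C: "\<And>b. b \<in> set bs \<Longrightarrow> bounded_linear (C b)"
    and deriv: "\<And>x. x \<in> cball w (real (length bs) * h) \<Longrightarrow>
      \<exists>L. (u has_derivative L) (at x) \<and> (\<Sum>b\<in>set bs. C b (L b)) = 0"
  shows "(\<Sum>b\<in>set bs. C b (face_diff h bs b u w)) = 0"
proof (rule ccontr)
  define n where "n = length bs"
  define \<Phi> where "\<Phi> = (\<lambda>h w. \<Sum>b\<in>set bs. C b (face_diff h bs b u w))"
  define H where "H = (\<lambda>m. h / 2 ^ m)"
  \<comment> \<open>The size of the flux relative to \<open>h ^ n\<close> for the initial box;
    bisection always finds a subbox with at least this ratio.\<close>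
  define c where "c = norm (\<Phi> h w) / h ^ n"
  assume "(\<Sum>b\<in>set bs. C b (face_diff h bs b u w)) \<noteq> 0"
  then have c: "c > 0" using h by (simp add: c_def \<Phi>_def)
  have n: "n > 0"
    using \<open>_ \<noteq> 0\<close> unfolding n_def by (metis length_greater_0_conv empty_set sum.empty)
  have H: "H m > 0" "H m = 2 * H (Suc m)" for m using h by (simp_all add: H_def)
  have double: "\<Phi> (2 * k) = vertex_sum k bs (\<Phi> k)" if "k \<ge> 0" for k
    unfolding \<Phi>_def
    by (subst averaging_op_sum[OF averaging_op_vertex_sum])
       (auto simp: face_diff_double[OF u that] C averaging_op_continuous[OF averaging_op_face_diff u])
  \<comment> \<open>The clause for \<open>m = 0\<close> pins the start of the sequence to the given
    box, so that the limit point lies where \<open>deriv\<close> applies.\<close>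
  have "\<exists>W. \<forall>m. (c * H m ^ n \<le> norm (\<Phi> (H m) (W m)) \<and> (m = 0 \<longrightarrow> W m = w)) \<and>
          W (Suc m) \<in> cball (W m) (real n * H (Suc m))"
  proof (rule dependent_nat_choice)
    show "\<exists>x. c * H 0 ^ n \<le> norm (\<Phi> (H 0) x) \<and> ((0::nat) = 0 \<longrightarrow> x = w)"
      using h by (intro exI[of _ w]) (simp add: c_def H_def)
    fix x m assume x: "c * H m ^ n \<le> norm (\<Phi> (H m) x) \<and> (m = 0 \<longrightarrow> x = w)"
    have "\<exists>y\<in>cball x (real n * H (Suc m)). c * H (Suc m) ^ n \<le> norm (\<Phi> (H (Suc m)) y)"
    proof (rule ccontr)
      \<comment> \<open>If every subbox had a ratio below \<open>c\<close>, so would the box itself,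
        because \<open>\<Phi>\<close> is additive under bisection.\<close>
      assume "\<not> ?thesis"
      then have "norm (vertex_sum (H (Suc m)) bs (\<Phi> (H (Suc m))) x) < 2 ^ length bs * (c * H (Suc m) ^ n)"
        using H(1)[of "Suc m"] by (intro vertex_sum_bound bs) (auto simp: n_def not_le)
      also have "\<dots> = c * H m ^ n"
        by (simp add: H(2)[of m] power_mult_distrib n_def)
      also have "vertex_sum (H (Suc m)) bs (\<Phi> (H (Suc m))) = \<Phi> (H m)"
        using double[of "H (Suc m)"] H(1)[of "Suc m"] by (simp add: H(2)[of m])
      finally show False using x by simp
    qed
    then show "\<exists>y. (c * H (Suc m) ^ n \<le> norm (\<Phi> (H (Suc m)) y) \<and> (Suc m = 0 \<longrightarrow> y = w)) \<and>
        y \<in> cball x (real n * H (Suc m))" by auto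
  qed
  then obtain W where W: "\<And>m. c * H m ^ n \<le> norm (\<Phi> (H m) (W m))" "W 0 = w"
    "\<And>m. W (Suc m) \<in> cball (W m) (real n * H (Suc m))" by blast
  \<comment> \<open>Closed balls replace the boxes: the edge vectors have norm at most 1, so
    \<open>F m\<close> contains the box at \<open>W m\<close>. The radius halves with the side and
    the centre moves by at most the new radius, hence the balls are nested.\<close>
  define F where "F = (\<lambda>m. cball (W m) (real n * H m))"
  have "F (Suc m) \<subseteq> F m" for m
  proof
    fix y assume "y \<in> F (Suc m)"
    then show "y \<in> F m"
      using cball_trans[OF W(3)[of m], of y "real n * H (Suc m)"] by (simp add: F_def H(2)[of m])
  qed
  then have "F k \<subseteq> F m" if "m \<le> k" for m k
    using lift_Suc_antimono_le[of F, OF _ that] by blast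
  then have "\<Inter>(range F) \<noteq> {}"
    using H(1) by (intro compact_nest) (auto simp: F_def not_less less_imp_le)
  then obtain x where x: "\<And>m. x \<in> F m" by blast
  obtain L where L: "(u has_derivative L) (at x)" "(\<Sum>b\<in>set bs. C b (L b)) = 0"
    using deriv[of x] x[of 0] by (auto simp: F_def W H_def n_def)
  have lin: "bounded_linear L" by (rule has_derivative_bounded_linear[OF L(1)])
  have "\<forall>b\<in>set bs. \<exists>K>0. \<forall>y. norm (C b y) \<le> norm y * K"
    using C bounded_linear.pos_bounded by blast
  then obtain K where K: "\<And>b. b \<in> set bs \<Longrightarrow> K b > 0" "\<And>b y. b \<in> set bs \<Longrightarrow> norm (C b y) \<le> norm y * K b"
    by metis
  define \<kappa> where "\<kappa> = (\<Sum>b\<in>set bs. K b)"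
  have \<kappa>: "\<kappa> \<ge> 0" unfolding \<kappa>_def by (intro sum_nonneg) (use K in \<open>auto simp: less_imp_le\<close>)
  \<comment> \<open>Chosen so that the final estimate \<open>4 * real n * \<kappa> * e\<close> stays
    below \<open>c\<close>; the added 1 keeps the denominator positive and the inequality
    strict.\<close>
  define e where "e = c / (4 * real n * \<kappa> + 1)"
  have e: "e > 0" using c \<kappa> unfolding e_def by (intro divide_pos_pos add_nonneg_pos) auto
  have "4 * real n * \<kappa> + 1 > 0" using \<kappa> by (intro add_nonneg_pos) auto
  then have ec: "4 * real n * \<kappa> * e < c" using c by (simp add: e_def field_simps)
  obtain d where d: "d > 0" "\<And>y. norm (y - x) < d \<Longrightarrow> norm (u y - u x - L (y - x)) \<le> e * norm (y - x)"
    using L(1) e unfolding has_derivative_at_alt by blast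
  have "H \<longlonglongrightarrow> 0" unfolding H_def by real_asymp
  then have "(\<lambda>m. 2 * real n * H m) \<longlonglongrightarrow> 2 * real n * 0" by (intro tendsto_intros)
  then have "\<forall>\<^sub>F m in sequentially. 2 * real n * H m < d"
    using order_tendstoD(2) d(1) by fastforce
  then obtain m where m: "2 * real n * H m < d" by (auto simp: eventually_sequentially)
  define r where "r = (\<lambda>y. u y - u x - L (y - x))"
  define a where "a = (\<lambda>y. u x + L (y - x))"
  have cont: "continuous_on UNIV a" "continuous_on UNIV r"
    unfolding a_def r_def
    by (intro continuous_intros u bounded_linear.continuous_on[OF lin])+
  have r: "norm (r y) \<le> e * (2 * real n * H m)" if "y \<in> cball (W m) (real n * H m)" for y
  proof -
    have "norm (y - x) \<le> 2 * real n * H m"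
      using that x[of m] dist_triangle[of y x "W m"] by (auto simp: F_def dist_norm norm_minus_commute)
    then show ?thesis
      using d(2)[of y] m e mult_left_mono[of "norm (y - x)" "2 * real n * H m" e]
      unfolding r_def by linarith
  qed
  have face: "face_diff (H m) bs b u (W m) = H m ^ n *\<^sub>R L b + face_diff (H m) bs b r (W m)"
    if "b \<in> set bs" for b
  proof -
    have "face_diff (H m) bs b u = face_diff (H m) bs b (\<lambda>y. a y + r y)"
      by (simp add: a_def r_def)
    also have "\<dots> = (\<lambda>y. face_diff (H m) bs b a y + face_diff (H m) bs b r y)"
      by (rule averaging_op_add[OF averaging_op_face_diff cont])
    also have "face_diff (H m) bs b a = (\<lambda>_. H m ^ n *\<^sub>R L b)"
      unfolding a_def n_def using face_diff_affine[OF lin _ that] H(1)[of m] by simp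
    finally show ?thesis by simp
  qed
  have "\<Phi> (H m) (W m) = (\<Sum>b\<in>set bs. H m ^ n *\<^sub>R C b (L b) + C b (face_diff (H m) bs b r (W m)))"
    unfolding \<Phi>_def
    by (intro sum.cong refl)
       (simp add: face C linear_add[OF bounded_linear.linear] linear_scale[OF bounded_linear.linear])
  \<comment> \<open>The affine part drops out by the differential equation at
    \<open>x\<close>.\<close>
  also have "\<dots> = (\<Sum>b\<in>set bs. C b (face_diff (H m) bs b r (W m)))"
    using L(2) by (simp add: sum.distrib flip: scaleR_sum_right)
  also have "norm \<dots> \<le> (\<Sum>b\<in>set bs. H m ^ (n - 1) * (2 * (e * (2 * real n * H m))) * K b)"
  proof (intro sum_norm_le)
    fix b assume b: "b \<in> set bs"
    have "norm (face_diff (H m) bs b r (W m)) \<le> H m ^ (n - 1) * (2 * (e * (2 * real n * H m)))"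
      unfolding n_def
      by (rule face_diff_bound[OF cont(2) _ bs b]) (use r H(1)[of m] in \<open>auto simp: n_def\<close>)
    from mult_right_mono[OF this less_imp_le[OF K(1)[OF b]]]
    show "norm (C b (face_diff (H m) bs b r (W m))) \<le> H m ^ (n - 1) * (2 * (e * (2 * real n * H m))) * K b"
      by (rule order_trans[OF K(2)[OF b]])
  qed
  also have "\<dots> = (4 * real n * \<kappa> * e) * (H m ^ (n - 1) * H m)"
    unfolding \<kappa>_def sum_distrib_left[symmetric] by simp
  also have "H m ^ (n - 1) * H m = H m ^ n"
    by (rule power_minus_mult[OF n])
  also have "(4 * real n * \<kappa> * e) * H m ^ n < c * H m ^ n"
    using ec H(1)[of m] by (intro mult_strict_right_mono) auto
  finally show False using W(1)[of m] by simp
qed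

section \<open>Averages over shrinking boxes\<close>

lemma box_int_append: "box_int h (bs @ cs) u = box_int h bs (box_int h cs u)"
  by (simp add: box_int_def)

text \<open>After subtraction of the constant \<open>u w\<close>, continuity makes the integrand
  small on small boxes, and \<open>box_int_bound\<close> applies.\<close>

lemma box_int_average_tendsto:
  fixes u :: "'a::real_normed_vector \<Rightarrow> 'b::banach"
  assumes u: "continuous_on UNIV u" and H: "\<And>n. H n > 0" "H \<longlonglongrightarrow> 0"
    and bs: "\<And>b. b \<in> set bs \<Longrightarrow> norm b \<le> 1"
  shows "(\<lambda>n. box_int (H n) bs u w /\<^sub>R H n ^ length bs) \<longlonglongrightarrow> u w"
proof (rule metric_LIMSEQ_I)
  fix e :: real assume e: "e > 0"
  have "isCont u w" using u by (simp add: continuous_on_eq_continuous_at)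
  then obtain d where d: "d > 0" "\<And>x. dist x w < d \<Longrightarrow> dist (u x) (u w) < e / 2"
    using e unfolding continuous_at_eps_delta by (metis half_gt_zero)
  have "(\<lambda>n. real (length bs) * H n) \<longlonglongrightarrow> real (length bs) * 0" by (intro tendsto_intros H)
  then have "\<forall>\<^sub>F n in sequentially. real (length bs) * H n < d"
    using order_tendstoD(2) d(1) by fastforce
  moreover have "dist (box_int (H n) bs u w /\<^sub>R H n ^ length bs) (u w) < e" if "real (length bs) * H n < d" for n
  proof -
    have c: "continuous_on UNIV (\<lambda>x. u x - u w)" by (intro continuous_intros u)
    have bound: "norm (box_int (H n) bs (\<lambda>x. u x - u w) w) \<le> H n ^ length bs * (e / 2)"
    proof (rule box_int_bound[OF c _ bs, where w = w and R = 0])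
      fix x assume "x \<in> cball w (0 + real (length bs) * H n)"
      then have "dist (u x) (u w) < e / 2" using that by (intro d(2)) (simp add: dist_commute)
      then show "norm (u x - u w) \<le> e / 2" by (simp add: dist_norm)
    qed (use H(1)[of n] in auto)
    have "box_int (H n) bs (\<lambda>x. u x - u w) = (\<lambda>x. box_int (H n) bs u x - H n ^ length bs *\<^sub>R u w)"
      using averaging_op_diff[OF averaging_op_box_int u continuous_on_const] H(1)[of n]
      by (simp add: box_int_const less_imp_le)
    then have "box_int (H n) bs u w /\<^sub>R H n ^ length bs - u w
        = box_int (H n) bs (\<lambda>x. u x - u w) w /\<^sub>R H n ^ length bs"
      using H(1)[of n] by (simp add: scaleR_diff_right)
    then have "dist (box_int (H n) bs u w /\<^sub>R H n ^ length bs) (u w)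
        = norm (box_int (H n) bs (\<lambda>x. u x - u w) w) / H n ^ length bs"
      unfolding dist_norm using H(1)[of n] by (simp add: divide_inverse_commute)
    also have "\<dots> \<le> e / 2"
      using bound H(1)[of n] by (subst pos_divide_le_eq) (simp_all add: mult.commute)
    finally have "dist (box_int (H n) bs u w /\<^sub>R H n ^ length bs) (u w) \<le> e / 2" .
    then show ?thesis using e by simp
  qed
  ultimately show "\<exists>N. \<forall>n\<ge>N. dist (box_int (H n) bs u w /\<^sub>R H n ^ length bs) (u w) < e"
    by (auto simp: eventually_sequentially)
qed

section \<open>Real parts of holomorphic functions\<close>

text \<open>The criterion for total differentiability with one of the partial derivatives, here
  \<open>gy\<close>, continuous. It is applied on the product of two real lines and transported to
  the complex plane.\<close>

lemma complex_has_derivative_partials: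
  fixes g :: "complex \<Rightarrow> 'b::real_normed_vector"
  assumes x: "\<And>z. ((\<lambda>t. g (z + of_real t)) has_vector_derivative gx z) (at 0)"
    and y: "\<And>z. ((\<lambda>t. g (z + \<i> * of_real t)) has_vector_derivative gy z) (at 0)"
    and cont: "continuous_on UNIV gy"
  shows "(g has_derivative (\<lambda>h. Re h *\<^sub>R gx z + Im h *\<^sub>R gy z)) (at z)"
proof -
  have x': "((\<lambda>t. g (Complex t b)) has_derivative (\<lambda>h. h *\<^sub>R gx (Complex a b))) (at a)" for a b
  proof -
    have "((\<lambda>t. g (Complex a b + of_real t)) has_vector_derivative gx (Complex a b)) (at (a - a))"
      using x by simp
    then have "((\<lambda>t. g (Complex a b + of_real t)) \<circ> (\<lambda>t. t - a) has_vector_derivative 1 *\<^sub>R gx (Complex a b)) (at a)"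
      by (rule vector_diff_chain_at[rotated])
         (simp add: has_vector_derivative_diff_const flip: has_real_derivative_iff_has_vector_derivative)
    moreover have "Complex a b + of_real (t - a) = Complex t b" for t by (simp add: complex_eq_iff)
    ultimately show ?thesis by (simp only: has_vector_derivative_def o_def scaleR_one)
  qed
  have y': "((\<lambda>t. g (Complex a t)) has_derivative (\<lambda>h. h *\<^sub>R gy (Complex a b))) (at b)" for a b
  proof -
    have "((\<lambda>t. g (Complex a b + \<i> * of_real t)) has_vector_derivative gy (Complex a b)) (at (b - b))"
      using y by simp
    then have "((\<lambda>t. g (Complex a b + \<i> * of_real t)) \<circ> (\<lambda>t. t - b) has_vector_derivative 1 *\<^sub>R gy (Complex a b)) (at b)"
      by (rule vector_diff_chain_at[rotated])
         (simp add: has_vector_derivative_diff_const flip: has_real_derivative_iff_has_vector_derivative)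
    moreover have "Complex a b + \<i> * of_real (t - b) = Complex a t" for t by (simp add: complex_eq_iff)
    ultimately show ?thesis by (simp only: has_vector_derivative_def o_def scaleR_one)
  qed
  have "((\<lambda>(a, b). g (Complex a b)) has_derivative
      (\<lambda>(s, t). s *\<^sub>R gx (Complex (Re z) (Im z)) +
        blinfun_apply (blinfun_scaleR_left (gy (Complex (Re z) (Im z)))) t))
      (at (Re z, Im z) within UNIV \<times> UNIV)"
  proof (rule has_derivative_partialsI[where f = "\<lambda>a b. g (Complex a b)"
        and fx = "\<lambda>s. s *\<^sub>R gx (Complex (Re z) (Im z))"
        and fy = "\<lambda>a b. blinfun_scaleR_left (gy (Complex a b))"])
    have "continuous_on UNIV (\<lambda>p. Complex (fst p) (snd p))"
      unfolding Complex_eq by (intro continuous_intros)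
    from continuous_on_compose2[OF cont this]
    have "continuous_on UNIV (\<lambda>p. blinfun_scaleR_left (gy (Complex (fst p) (snd p))))"
      by (intro bounded_linear.continuous_on[OF bounded_linear_blinfun_scaleR_left]) simp
    then show "continuous (at (Re z, Im z) within UNIV \<times> UNIV)
        (\<lambda>(a, b). blinfun_scaleR_left (gy (Complex a b)))"
      by (simp add: case_prod_unfold continuous_on_eq_continuous_at)
    show "((\<lambda>a. g (Complex a (Im z))) has_derivative (\<lambda>s. s *\<^sub>R gx (Complex (Re z) (Im z))))
        (at (Re z) within UNIV)"
      using x'[of "Im z" "Re z"] by simp
    show "((\<lambda>b. g (Complex a b)) has_derivative blinfun_apply (blinfun_scaleR_left (gy (Complex a b))))
        (at b within UNIV)" for a b
      using y'[of a b] by simp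
  qed simp_all
  then have "((\<lambda>(a, b). g (Complex a b)) has_derivative (\<lambda>(s, t). s *\<^sub>R gx z + t *\<^sub>R gy z))
      (at (Re z, Im z))"
    by simp
  moreover have "((\<lambda>z. (Re z, Im z)) has_derivative (\<lambda>h. (Re h, Im h))) (at z)"
    by (auto intro!: derivative_eq_intros)
  ultimately show ?thesis
    using has_derivative_compose[of "\<lambda>z. (Re z, Im z)" "\<lambda>h. (Re h, Im h)" z UNIV
        "\<lambda>(a, b). g (Complex a b)" "\<lambda>(s, t). s *\<^sub>R gx z + t *\<^sub>R gy z"] by simp
qed

text \<open>The function \<open>ux - \<i> * uy\<close> satisfies the Cauchy-Riemann equations and so
  has a primitive on the disc, whose real part has the same gradient as \<open>u\<close>. The single
  \<open>uxy\<close>, a derivative of both \<open>ux\<close> and \<open>uy\<close>, encodes the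
  symmetry of second derivatives.\<close>

lemma harmonic_imp_Re_holomorphic:
  fixes u :: "complex \<Rightarrow> real"
  assumes ux: "\<And>z. ((\<lambda>t. u (z + of_real t)) has_vector_derivative ux z) (at 0)"
    and uy: "\<And>z. ((\<lambda>t. u (z + \<i> * of_real t)) has_vector_derivative uy z) (at 0)"
    and uxx: "\<And>z. ((\<lambda>t. ux (z + of_real t)) has_vector_derivative uxx z) (at 0)"
    and uxy: "\<And>z. ((\<lambda>t. ux (z + \<i> * of_real t)) has_vector_derivative uxy z) (at 0)"
    and uyx: "\<And>z. ((\<lambda>t. uy (z + of_real t)) has_vector_derivative uxy z) (at 0)"
    and uyy: "\<And>z. ((\<lambda>t. uy (z + \<i> * of_real t)) has_vector_derivative uyy z) (at 0)"
    and cont: "continuous_on UNIV uy" "continuous_on UNIV uxy" "continuous_on UNIV uyy"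
    and harm: "\<And>z. z \<in> ball 0 r \<Longrightarrow> uxx z + uyy z = 0"
  shows "\<exists>A. A holomorphic_on ball 0 r \<and> (\<forall>z\<in>ball 0 r. Re (A z) = u z)"
proof -
  define q where "q = (\<lambda>z. of_real (ux z) - \<i> * of_real (uy z))"
  note d = complex_has_derivative_partials[OF ux uy cont(1)]
    complex_has_derivative_partials[OF uxx uxy cont(2)] complex_has_derivative_partials[OF uyx uyy cont(3)]
  have q: "(q has_field_derivative (of_real (uxx z) - \<i> * of_real (uxy z))) (at z)" if "z \<in> ball 0 r" for z
  proof -
    have "(q has_derivative (\<lambda>h. of_real (Re h *\<^sub>R uxx z + Im h *\<^sub>R uxy z)
        - \<i> * of_real (Re h *\<^sub>R uxy z + Im h *\<^sub>R uyy z))) (at z)"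
      unfolding q_def
      by (intro has_derivative_diff has_derivative_mult_right has_derivative_of_real d)
    also have "uyy z = - uxx z" using harm[OF that] by simp
    also have "(\<lambda>h. of_real (Re h *\<^sub>R uxx z + Im h *\<^sub>R uxy z)
        - \<i> * of_real (Re h *\<^sub>R uxy z + Im h *\<^sub>R - uxx z)) = (*) (of_real (uxx z) - \<i> * of_real (uxy z))"
      by (rule ext) (simp add: complex_eq_iff)
    finally show ?thesis by (simp add: has_field_derivative_def)
  qed
  then have "q holomorphic_on ball 0 r"
    unfolding holomorphic_on_open[OF open_ball] by blast
  then obtain A where A: "\<And>z. z \<in> ball 0 r \<Longrightarrow> (A has_field_derivative q z) (at z)"
    using holomorphic_convex_primitive'[of "ball 0 r" q] by (auto simp: at_within_open[of _ "ball 0 r"])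
  have "((\<lambda>z. u z - Re (A z)) has_derivative (\<lambda>h. 0)) (at z within ball 0 r)" if "z \<in> ball 0 r" for z
  proof -
    have "((\<lambda>z. u z - Re (A z)) has_derivative (\<lambda>h. Re h *\<^sub>R ux z + Im h *\<^sub>R uy z - Re (q z * h))) (at z)"
      using A[OF that] unfolding has_field_derivative_def
      by (intro has_derivative_diff has_derivative_Re d)
    also have "(\<lambda>h. Re h *\<^sub>R ux z + Im h *\<^sub>R uy z - Re (q z * h)) = (\<lambda>h. 0)"
      by (rule ext) (simp add: q_def mult.commute)
    finally show ?thesis by (rule has_derivative_at_withinI)
  qed
  then obtain c where c: "\<And>z. z \<in> ball 0 r \<Longrightarrow> u z - Re (A z) = c"
    using has_derivative_zero_constant[OF convex_ball, of 0 r "\<lambda>z. u z - Re (A z)"] by blast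
  show ?thesis
  proof (intro exI conjI ballI)
    have "A holomorphic_on ball 0 r"
      unfolding holomorphic_on_open[OF open_ball] using A by blast
    then show "(\<lambda>z. A z + of_real c) holomorphic_on ball 0 r"
      by (intro holomorphic_intros)
    show "Re (A z + of_real c) = u z" if "z \<in> ball 0 r" for z using c[OF that] by simp
  qed
qed

text \<open>Montel's theorem is applied to the exponentials, which are bounded because the real parts are.\<close>

lemma Re_holomorphic_limit:
  fixes A :: "nat \<Rightarrow> complex \<Rightarrow> complex"
  assumes hol: "\<And>n. A n holomorphic_on ball 0 r" and r: "r > 0"
    and bound: "\<And>n z. z \<in> ball 0 r \<Longrightarrow> Re (A n z) \<le> B"
    and lim: "\<And>z. z \<in> ball 0 r \<Longrightarrow> (\<lambda>n. Re (A n z)) \<longlonglongrightarrow> v z"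
  shows "\<exists>A. A holomorphic_on ball 0 r \<and> (\<forall>z\<in>ball 0 r. Re (A z) = v z)"
proof -
  define E where "E = (\<lambda>n z. exp (A n z))"
  obtain g s where g: "g holomorphic_on ball 0 r" and s: "strict_mono (s :: nat \<Rightarrow> nat)"
    and lim_g: "\<And>z. z \<in> ball 0 r \<Longrightarrow> (\<lambda>n. E (s n) z) \<longlonglongrightarrow> g z"
  proof (rule Montel[of "ball 0 r" "range E" E])
    show "h holomorphic_on ball 0 r" if "h \<in> range E" for h
      using that hol unfolding E_def by (auto intro!: holomorphic_intros)
    show "\<exists>B. \<forall>h\<in>range E. \<forall>z\<in>K. norm (h z) \<le> B" if "compact K" "K \<subseteq> ball 0 r" for K
      using bound that by (intro exI[of _ "exp B"]) (auto simp: E_def norm_exp_eq_Re)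
  qed auto
  have norm_g: "norm (g z) = exp (v z)" if "z \<in> ball 0 r" for z
  proof (rule LIMSEQ_unique)
    show "(\<lambda>n. norm (E (s n) z)) \<longlonglongrightarrow> norm (g z)"
      by (intro tendsto_norm lim_g that)
    have "(\<lambda>n. norm (E n z)) \<longlonglongrightarrow> exp (v z)"
      unfolding E_def norm_exp_eq_Re by (intro tendsto_exp lim that)
    from LIMSEQ_subseq_LIMSEQ[OF this s] show "(\<lambda>n. norm (E (s n) z)) \<longlonglongrightarrow> exp (v z)"
      by (simp add: o_def)
  qed
  \<comment> \<open>The modulus \<open>exp (v z)\<close> is positive, so the limit has no zeros and
    admits a logarithm on the disc.\<close>
  then have "g z \<noteq> 0" if "z \<in> ball 0 r" for z
    using that by (metis exp_not_eq_zero norm_zero)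
  then obtain A where A: "A holomorphic_on ball 0 r" "\<And>z. z \<in> ball 0 r \<Longrightarrow> exp (A z) = g z"
    using holomorphic_logarithm_exists[OF convex_ball open_ball g, of 0] r by auto
  moreover have "Re (A z) = v z" if "z \<in> ball 0 r" for z
    using norm_g[OF that] A(2)[OF that, symmetric] by (simp add: norm_exp_eq_Re)
  ultimately show ?thesis by blast
qed

section \<open>Left regular functions\<close>

abbreviation h0_basis :: "hyper0 list" where
  "h0_basis \<equiv> [1, h0_i, h0_j, h0_k]"

lemma norm_h0_basis: "b \<in> set h0_basis \<Longrightarrow> norm b \<le> 1"
  by (auto simp: norm_hyper0_def inner_hyper0_def)

lemma sum_h0_basis: "(\<Sum>b\<in>set h0_basis. g b) = g 1 + g h0_i + g h0_j + g h0_k"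
  by (simp add: hyper0_eq_iff add.assoc)

lemma bounded_linear_h0_mult: "bounded_linear (\<lambda>y. b * y :: hyper0)"
  by (simp add: linear_conv_bounded_linear[symmetric] linear_iff algebra_simps)

lemma has_derivative_line:
  fixes f :: "'a::real_normed_vector \<Rightarrow> 'b::real_normed_vector"
  assumes "(f has_derivative L) (at w)"
  shows "((\<lambda>t. f (w + t *\<^sub>R b)) has_vector_derivative L b) (at 0)"
proof -
  have g: "((\<lambda>t::real. w + t *\<^sub>R b) has_derivative (\<lambda>t. t *\<^sub>R b)) (at 0)"
    by (auto intro!: derivative_eq_intros)
  have "((\<lambda>t. f (w + t *\<^sub>R b)) has_derivative (\<lambda>t. L (t *\<^sub>R b))) (at 0)"
    using has_derivative_compose[OF g, of f L] assms by simp
  then show ?thesis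
    by (simp add: has_vector_derivative_def linear_scale[OF has_derivative_linear[OF assms]])
qed

lemma partial_eq:
  assumes "(f has_derivative L) (at w)"
  shows "partial b f w = L b"
  unfolding partial_def by (rule vector_derivative_at[OF has_derivative_line[OF assms]])

text \<open>By \<open>box_int_vector_derivative\<close>, \<open>P b\<close> differentiates the box
  integral along \<open>b\<close>. The factorization of the Laplacian can therefore be carried out
  with these commuting operators in place of partial derivatives.\<close>

lemma smoothed_laplacian_eq_0:
  assumes u: "continuous_on UNIV u" and h: "h > 0" "16 * h \<le> \<rho>"
    and reg: "\<And>x. x \<in> ball w0 \<rho> \<Longrightarrow> u differentiable at x \<and> nabla0 u x = 0"
    and w: "w \<in> ball w0 (\<rho> / 2)"
  defines "P \<equiv> face_diff h h0_basis"
  shows "P 1 (P 1 u) w + P h0_i (P h0_i u) w = 0"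
proof -
  define \<Phi> where "\<Phi> = (\<lambda>x. \<Sum>b\<in>set h0_basis. b * P b u x)"
  define Q where "Q = (\<lambda>c b. P c (P b u) w)"
  have cP: "continuous_on UNIV (P b u)" for b
    unfolding P_def by (intro averaging_op_continuous[OF averaging_op_face_diff u])
  \<comment> \<open>The values of \<open>\<Phi>\<close> on this ball determine
    \<open>P c \<Phi> w\<close>. The boxes involved stay within \<open>8 * h\<close> of
    \<open>w\<close>, and \<open>8 * h \<le> \<rho> / 2\<close> keeps them in
    \<open>ball w0 \<rho>\<close>.\<close>
  have \<Phi>: "\<Phi> x = 0" if "x \<in> cball w (4 * h)" for x
    unfolding \<Phi>_def P_def
  proof (rule box_flux_eq_0[OF u h(1) norm_h0_basis bounded_linear_h0_mult])
    fix y assume y: "y \<in> cball x (real (length h0_basis) * h)"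
    then have "y \<in> ball w0 \<rho>"
      using that w h dist_triangle[of w0 y w] dist_triangle[of w y x] by auto
    then have "u differentiable at y" and n: "nabla0 u y = 0" using reg by auto
    then obtain L where L: "(u has_derivative L) (at y)" by (auto simp: differentiable_def)
    then show "\<exists>L. (u has_derivative L) (at y) \<and> (\<Sum>b\<in>set h0_basis. b * L b) = 0"
      using n by (intro exI[of _ L]) (simp only: sum_h0_basis nabla0_def partial_eq[OF L], simp)
  qed
  have zero: "(\<Sum>b\<in>set h0_basis. b * Q c b) = 0" if "c \<in> set h0_basis" for c
  proof -
    have "continuous_on UNIV \<Phi>"
      unfolding \<Phi>_def by (intro continuous_on_sum bounded_linear.continuous_on[OF bounded_linear_h0_mult] cP)
    \<comment> \<open>The estimate for face differences is used with the bound 0.\<close>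
    then have "norm (P c \<Phi> w) \<le> h ^ (length h0_basis - 1) * (2 * 0)"
      unfolding P_def using h that
      by (intro face_diff_bound norm_h0_basis) (auto simp: \<Phi> simp del: set_simps)
    moreover have "P c \<Phi> = (\<lambda>w. \<Sum>b\<in>set h0_basis. b * P c (P b u) w)"
      unfolding \<Phi>_def P_def
      by (intro averaging_op_sum[OF averaging_op_face_diff] bounded_linear_h0_mult cP[unfolded P_def]) simp
    ultimately show ?thesis by (simp add: Q_def)
  qed
  have comm: "Q b c = Q c b" for b c
    unfolding Q_def P_def
    by (simp add: averaging_op_face_diff_commute[OF averaging_op_face_diff u])
  \<comment> \<open>The conjugate operator applied to the four vanishing sums. As \<open>Q\<close>
    is symmetric, the mixed terms carry factors such as \<open>h0_i * h0_j + h0_j * h0_i\<close>,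
    which are 0; the squares of \<open>h0_j\<close> and \<open>h0_k\<close> vanish, and that of
    \<open>h0_i\<close> gives the second term.\<close>
  have "Q 1 1 + Q h0_i h0_i =
      (Q 1 1 + h0_i * Q 1 h0_i + h0_j * Q 1 h0_j + h0_k * Q 1 h0_k)
    - h0_i * (Q h0_i 1 + h0_i * Q h0_i h0_i + h0_j * Q h0_i h0_j + h0_k * Q h0_i h0_k)
    - h0_j * (Q h0_j 1 + h0_i * Q h0_j h0_i + h0_j * Q h0_j h0_j + h0_k * Q h0_j h0_k)
    - h0_k * (Q h0_k 1 + h0_i * Q h0_k h0_i + h0_j * Q h0_k h0_j + h0_k * Q h0_k h0_k)"
    by (simp add: comm[of h0_i 1] comm[of h0_j 1] comm[of h0_k 1] comm[of h0_j h0_i]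
        comm[of h0_k h0_i] comm[of h0_k h0_j] hyper0_eq_iff)
  also have "\<dots> = 0"
    using zero[of 1] zero[of h0_i] zero[of h0_j] zero[of h0_k] by (simp only: sum_h0_basis) simp
  finally show ?thesis by (simp add: Q_def)
qed

section \<open>The plane of \<open>1\<close> and \<open>h0_i\<close>, identified isometrically with
  the complex numbers\<close>

definition h0_plane :: "complex \<Rightarrow> hyper0" where
  "h0_plane z = Re z *\<^sub>R 1 + Im z *\<^sub>R h0_i"

lemma h0_plane_add: "h0_plane (z + z') = h0_plane z + h0_plane z'"
  by (simp add: h0_plane_def algebra_simps)

lemma h0_plane_scaleR: "h0_plane (t *\<^sub>R z) = t *\<^sub>R h0_plane z"
  by (simp add: h0_plane_def algebra_simps)

lemma h0_plane_1 [simp]: "h0_plane 1 = 1" and h0_plane_ii [simp]: "h0_plane \<i> = h0_i"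
  by (simp_all add: h0_plane_def)

lemma norm_h0_plane: "norm (h0_plane z) = norm z"
  by (simp add: h0_plane_def norm_hyper0_def inner_hyper0_def cmod_def power2_eq_square)

lemma continuous_h0_plane: "continuous_on S h0_plane"
  unfolding h0_plane_def by (intro continuous_intros)

text \<open>Each of the two integrations absorbs one derivative: along the plane the first
  derivatives of \<open>M (M u)\<close> are \<open>M (P b u)\<close>, the second ones
  \<open>P c (P b u)\<close>. The functional \<open>\<L>\<close> passes to real-valued functions, as
  needed for real parts.\<close>

lemma smoothing_eq_Re_holomorphic:
  fixes \<L> :: "hyper0 \<Rightarrow> real"
  assumes u: "continuous_on UNIV u" and h: "h > 0" "16 * h \<le> \<rho>"
    and reg: "\<And>x. x \<in> ball w0 \<rho> \<Longrightarrow> u differentiable at x \<and> nabla0 u x = 0"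
    and L: "bounded_linear \<L>"
  shows "\<exists>A. A holomorphic_on ball 0 (\<rho> / 2) \<and>
    (\<forall>z\<in>ball 0 (\<rho> / 2). Re (A z) = \<L> (box_int h (h0_basis @ h0_basis) u (w0 + h0_plane z)))"
proof -
  define M where "M = (\<lambda>v::hyper0 \<Rightarrow> hyper0. box_int h h0_basis v)"
  define P where "P = (\<lambda>b. \<lambda>v::hyper0 \<Rightarrow> hyper0. face_diff h h0_basis b v)"
  have aM: "averaging_op M" and aP: "averaging_op (P b)" for b
    unfolding M_def P_def by (rule averaging_op_box_int averaging_op_face_diff)+
  have cM: "continuous_on UNIV (M v)" and cP: "continuous_on UNIV (P b v)"
    if "continuous_on UNIV v" for b v
    by (rule averaging_op_continuous[OF aM that] averaging_op_continuous[OF aP that])+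
  have PM: "P b (M v) = M (P b v)" and PP: "P b (P c v) = P c (P b v)"
    if "continuous_on UNIV v" for b c v
    using averaging_op_box_int_commute[OF aP that, of b h h0_basis]
      averaging_op_face_diff_commute[OF aP that, of b h h0_basis c]
    by (simp_all only: M_def P_def)
  have c: "continuous_on UNIV (\<lambda>z. \<L> (v (w0 + h0_plane z)))" if "continuous_on UNIV v" for v
    by (intro bounded_linear.continuous_on[OF L] continuous_on_compose2[OF that] continuous_intros
        continuous_h0_plane) auto
  have d: "((\<lambda>t. \<L> (M v (w0 + h0_plane (z + of_real t)))) has_vector_derivative
        \<L> (P 1 v (w0 + h0_plane z))) (at 0)"
      "((\<lambda>t. \<L> (M v (w0 + h0_plane (z + \<i> * of_real t)))) has_vector_derivative
        \<L> (P h0_i v (w0 + h0_plane z))) (at 0)"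
    if v: "continuous_on UNIV v" for v z
  proof -
    have *: "((\<lambda>t. M v (w0 + h0_plane z + t *\<^sub>R b)) has_vector_derivative
        P b v (w0 + h0_plane z)) (at 0)" if "b \<in> set h0_basis" for b
      using box_int_vector_derivative[OF v _ that, of h "w0 + h0_plane z" 0] h
      by (simp add: M_def P_def)
    have "h0_plane (z + of_real t) = h0_plane z + t *\<^sub>R 1"
      "h0_plane (z + \<i> * of_real t) = h0_plane z + t *\<^sub>R h0_i" for t
      by (simp_all add: h0_plane_def algebra_simps)
    then show "((\<lambda>t. \<L> (M v (w0 + h0_plane (z + of_real t)))) has_vector_derivative
        \<L> (P 1 v (w0 + h0_plane z))) (at 0)"
      "((\<lambda>t. \<L> (M v (w0 + h0_plane (z + \<i> * of_real t)))) has_vector_derivative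
        \<L> (P h0_i v (w0 + h0_plane z))) (at 0)"
      using bounded_linear.has_vector_derivative[OF L *[of 1]]
        bounded_linear.has_vector_derivative[OF L *[of h0_i]] by (simp_all add: add.assoc)
  qed
  have "\<exists>A. A holomorphic_on ball 0 (\<rho> / 2) \<and>
    (\<forall>z\<in>ball 0 (\<rho> / 2). Re (A z) = \<L> (M (M u) (w0 + h0_plane z)))"
  proof (rule harmonic_imp_Re_holomorphic[where ux = "\<lambda>z. \<L> (M (P 1 u) (w0 + h0_plane z))" and uy = "\<lambda>z. \<L> (M (P h0_i u) (w0 + h0_plane z))"
        and uxx = "\<lambda>z. \<L> (P 1 (P 1 u) (w0 + h0_plane z))"
        and uxy = "\<lambda>z. \<L> (P h0_i (P 1 u) (w0 + h0_plane z))"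
        and uyy = "\<lambda>z. \<L> (P h0_i (P h0_i u) (w0 + h0_plane z))"])
    show "((\<lambda>t. \<L> (M (M u) (w0 + h0_plane (z + of_real t)))) has_vector_derivative
        \<L> (M (P 1 u) (w0 + h0_plane z))) (at 0)" for z
      using d(1)[OF cM[OF u]] by (simp only: PM[OF u])
    show "((\<lambda>t. \<L> (M (M u) (w0 + h0_plane (z + \<i> * of_real t)))) has_vector_derivative
        \<L> (M (P h0_i u) (w0 + h0_plane z))) (at 0)" for z
      using d(2)[OF cM[OF u]] by (simp only: PM[OF u])
    show "((\<lambda>t. \<L> (M (P 1 u) (w0 + h0_plane (z + of_real t)))) has_vector_derivative
        \<L> (P 1 (P 1 u) (w0 + h0_plane z))) (at 0)" for z
      by (rule d(1)[OF cP[OF u]])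
    show "((\<lambda>t. \<L> (M (P 1 u) (w0 + h0_plane (z + \<i> * of_real t)))) has_vector_derivative
        \<L> (P h0_i (P 1 u) (w0 + h0_plane z))) (at 0)" for z
      by (rule d(2)[OF cP[OF u]])
    show "((\<lambda>t. \<L> (M (P h0_i u) (w0 + h0_plane (z + of_real t)))) has_vector_derivative
        \<L> (P h0_i (P 1 u) (w0 + h0_plane z))) (at 0)" for z
      \<comment> \<open>Mixed derivatives agree because face differences commute.\<close>
      unfolding PP[OF u, of h0_i 1] by (rule d(1)[OF cP[OF u]])
    show "((\<lambda>t. \<L> (M (P h0_i u) (w0 + h0_plane (z + \<i> * of_real t)))) has_vector_derivative
        \<L> (P h0_i (P h0_i u) (w0 + h0_plane z))) (at 0)" for z
      by (rule d(2)[OF cP[OF u]])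
    show "\<L> (P 1 (P 1 u) (w0 + h0_plane z)) + \<L> (P h0_i (P h0_i u) (w0 + h0_plane z)) = 0"
      if "z \<in> ball 0 (\<rho> / 2)" for z
    proof -
      have "w0 + h0_plane z \<in> ball w0 (\<rho> / 2)"
        using that by (simp add: dist_norm norm_h0_plane)
      then have "P 1 (P 1 u) (w0 + h0_plane z) + P h0_i (P h0_i u) (w0 + h0_plane z) = 0"
        unfolding P_def by (intro smoothed_laplacian_eq_0[OF u h] reg)
      then show ?thesis
        using linear_add[OF bounded_linear.linear[OF L]] linear_0[OF bounded_linear.linear[OF L]] by metis
    qed
  next
    show "continuous_on UNIV (\<lambda>z. \<L> (M (P h0_i u) (w0 + h0_plane z)))"
      "continuous_on UNIV (\<lambda>z. \<L> (P h0_i (P 1 u) (w0 + h0_plane z)))"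
      "continuous_on UNIV (\<lambda>z. \<L> (P h0_i (P h0_i u) (w0 + h0_plane z)))"
      by (rule c[OF cM[OF cP[OF u]]] c[OF cP[OF cP[OF u]]])+
  qed
  then show ?thesis by (simp only: box_int_append M_def)
qed

text \<open>Averages over ever smaller boxes converge to \<open>f\<close> and are uniformly bounded,
  so \<open>Re_holomorphic_limit\<close> carries the representation over from the smoothed
  functions.\<close>

proposition left_regular_eq_Re_holomorphic:
  fixes \<L> :: "hyper0 \<Rightarrow> real"
  assumes \<rho>: "\<rho> > 0" and f: "continuous_on (cball w0 \<rho>) f"
    and reg: "\<And>x. x \<in> ball w0 \<rho> \<Longrightarrow> f differentiable at x \<and> nabla0 f x = 0"
    and L: "bounded_linear \<L>"
  shows "\<exists>A. A holomorphic_on ball 0 (\<rho> / 2) \<and>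
    (\<forall>z\<in>ball 0 (\<rho> / 2). Re (A z) = \<L> (f (w0 + h0_plane z)))"
proof -
  \<comment> \<open>The box operators act on functions continuous everywhere; projection onto the
    closed ball extends \<open>f\<close> to such a function, with bounded values.\<close>
  define u where "u = (\<lambda>x. f (closest_point (cball w0 \<rho>) x))"
  define H where "H = (\<lambda>n. \<rho> / (16 * (real n + 1)))"
  \<comment> \<open>The number of integrations in the double smoothing; division by
    \<open>H n ^ k\<close> turns the integral into an average.\<close>
  define k where "k = length (h0_basis @ h0_basis)"
  have H: "H n > 0" "16 * H n \<le> \<rho>" for n
    using \<rho> by (simp_all add: H_def field_simps)
  have H0: "H \<longlonglongrightarrow> 0" unfolding H_def by real_asymp
  have cp: "closest_point (cball w0 \<rho>) x \<in> cball w0 \<rho>" for x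
    using \<rho> by (intro closest_point_in_set) auto
  have u: "continuous_on UNIV u"
    unfolding u_def using \<rho> cp
    by (intro continuous_on_compose2[OF f] continuous_on_closest_point) auto
  have uf: "u x = f x" if "x \<in> ball w0 \<rho>" for x
    using that by (simp add: u_def closest_point_self)
  have "bounded (f ` cball w0 \<rho>)"
    by (intro compact_imp_bounded compact_continuous_image f compact_cball)
  then obtain B where B: "\<And>x. norm (u x) \<le> B"
    using cp unfolding u_def bounded_iff by blast
  have reg_u: "u differentiable at x \<and> nabla0 u x = 0" if x: "x \<in> ball w0 \<rho>" for x
  proof -
    obtain F where F: "(f has_derivative F) (at x)" "nabla0 f x = 0"
      using reg[OF x] by (auto simp: differentiable_def)
    have U: "(u has_derivative F) (at x)"
      by (rule has_derivative_transform_within_open[OF F(1) open_ball x]) (simp add: uf)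
    then show ?thesis
      using F(2) unfolding nabla0_def partial_eq[OF F(1)] partial_eq[OF U] by (auto simp: differentiable_def)
  qed
  define g where "g = (\<lambda>n. box_int (H n) (h0_basis @ h0_basis) u)"
  have "\<exists>A. A holomorphic_on ball 0 (\<rho> / 2) \<and>
      (\<forall>z\<in>ball 0 (\<rho> / 2). Re (A z) = \<L> (g n (w0 + h0_plane z)))" for n
    unfolding g_def by (rule smoothing_eq_Re_holomorphic[OF u H reg_u L])
  then obtain A where A: "\<And>n. A n holomorphic_on ball 0 (\<rho> / 2)"
    "\<And>n z. z \<in> ball 0 (\<rho> / 2) \<Longrightarrow> Re (A n z) = \<L> (g n (w0 + h0_plane z))" by metis
  obtain K where K: "K > 0" "\<And>x. norm (\<L> x) \<le> norm x * K"
    using bounded_linear.pos_bounded[OF L] by blast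
  have eq: "Re (of_real (inverse (H n ^ k)) * A n z) = \<L> (g n (w0 + h0_plane z) /\<^sub>R H n ^ k)"
    if "z \<in> ball 0 (\<rho> / 2)" for n z
  proof -
    have "Re (of_real c * y) = c * Re y" for c y by simp
    then show ?thesis
      by (simp only: A(2)[OF that, of n] linear_scale[OF bounded_linear.linear[OF L]] real_scaleR_def)
  qed
  show ?thesis
  proof (rule Re_holomorphic_limit)
    show "(\<lambda>z. of_real (inverse (H n ^ k)) * A n z) holomorphic_on ball 0 (\<rho> / 2)" for n
      by (intro holomorphic_intros A)
    show "Re (of_real (inverse (H n ^ k)) * A n z) \<le> B * K" if "z \<in> ball 0 (\<rho> / 2)" for n z
    proof -
      define x where "x = w0 + h0_plane z"
      have "norm (g n x) \<le> H n ^ k * B"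
        unfolding g_def k_def
        by (rule box_int_bound[OF u _ norm_h0_basis, where w = x and R = 0])
           (use H(1)[of n] B in auto)
      then have "norm (g n x /\<^sub>R H n ^ k) \<le> B"
        using H(1)[of n] by (simp add: pos_divide_le_eq mult.commute flip: divide_inverse)
      then have "norm (\<L> (g n x /\<^sub>R H n ^ k)) \<le> B * K"
        using K(1) by (intro order_trans[OF K(2)] mult_right_mono) auto
      then show ?thesis unfolding eq[OF that] x_def by simp
    qed
    show "(\<lambda>n. Re (of_real (inverse (H n ^ k)) * A n z)) \<longlonglongrightarrow> \<L> (f (w0 + h0_plane z))"
      if "z \<in> ball 0 (\<rho> / 2)" for z
    proof -
      have "w0 + h0_plane z \<in> ball w0 \<rho>"
        using that \<rho> by (simp add: dist_norm norm_h0_plane)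
      moreover have "(\<lambda>n. g n (w0 + h0_plane z) /\<^sub>R H n ^ k) \<longlonglongrightarrow> u (w0 + h0_plane z)"
        unfolding g_def k_def
        by (rule box_int_average_tendsto[OF u H(1) H0 norm_h0_basis]) auto
      ultimately show ?thesis
        unfolding eq[OF that] using uf by (metis bounded_linear.tendsto[OF L])
    qed
  qed (use \<rho> in auto)
qed

text \<open>Along a line in direction \<open>d\<close> inside the disc, \<open>\<L>\<close> of
  \<open>f\<close> is the real part of \<open>A\<close>, and each differentiation of
  \<open>A\<close> along the line brings out a factor \<open>d\<close>.\<close>

lemma second_partial_component:
  fixes \<L> :: "hyper0 \<Rightarrow> real"
  assumes r: "r > 0" and A: "A holomorphic_on ball 0 r"
    and eq: "\<And>z. z \<in> ball 0 r \<Longrightarrow> Re (A z) = \<L> (f (w + h0_plane z))"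
    and diff: "\<And>z. z \<in> ball 0 r \<Longrightarrow> f differentiable at (w + h0_plane z)"
    and L: "bounded_linear \<L>" and d: "norm d = 1"
  shows "((\<lambda>t. \<L> (partial (h0_plane d) f (w + t *\<^sub>R h0_plane d))) has_vector_derivative
           Re (d * d * deriv (deriv A) 0)) (at 0)"
proof -
  have line: "((\<lambda>t. Re (c * B (z + t *\<^sub>R d))) has_vector_derivative Re (c * (d * deriv B z))) (at 0)"
    if "B holomorphic_on ball 0 r" "z \<in> ball 0 r" for B z c
  proof -
    have "(B has_field_derivative deriv B z) (at z)"
      using that by (simp add: holomorphic_derivI)
    from has_derivative_line[OF this[unfolded has_field_derivative_def], of d]
    have "((\<lambda>t. B (z + t *\<^sub>R d)) has_vector_derivative d * deriv B z) (at 0)"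
      by (simp add: mult.commute)
    from bounded_linear.has_vector_derivative[OF bounded_linear_compose[OF bounded_linear_Re
          bounded_linear_mult_right[of c]] this]
    show ?thesis by simp
  qed
  \<comment> \<open>The first derivative is identified on the whole disc, since it is to be
    differentiated again.\<close>
  have first: "\<L> (partial (h0_plane d) f (w + h0_plane z)) = Re (d * deriv A z)" if z: "z \<in> ball 0 r" for z
  proof -
    obtain F where F: "(f has_derivative F) (at (w + h0_plane z))"
      using diff[OF z] by (auto simp: differentiable_def)
    have "((\<lambda>t. \<L> (f (w + h0_plane z + t *\<^sub>R h0_plane d))) has_vector_derivative \<L> (F (h0_plane d))) (at 0)"
      by (rule bounded_linear.has_vector_derivative[OF L has_derivative_line[OF F]])
    moreover have "((\<lambda>t. \<L> (f (w + h0_plane z + t *\<^sub>R h0_plane d))) has_vector_derivative Re (d * deriv A z)) (at 0)"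
    proof (rule has_vector_derivative_transform_within_open)
      show "((\<lambda>t. Re (A (z + t *\<^sub>R d))) has_vector_derivative Re (d * deriv A z)) (at 0)"
        using line[OF A z, of 1] by simp
      \<comment> \<open>For such \<open>t\<close> the point \<open>z + t *\<^sub>R d\<close> stays
        in the disc, as \<open>norm d = 1\<close>.\<close>
      show "open {- (r - norm z)<..<r - norm z}" "0 \<in> {- (r - norm z)<..<r - norm z}"
        using z by auto
      fix t assume "t \<in> {- (r - norm z)<..<r - norm z}"
      then have "z + t *\<^sub>R d \<in> ball 0 r"
        using norm_triangle_ineq[of z "t *\<^sub>R d"] d by auto
      from eq[OF this] show "Re (A (z + t *\<^sub>R d)) = \<L> (f (w + h0_plane z + t *\<^sub>R h0_plane d))"
        by (simp add: h0_plane_add h0_plane_scaleR add.assoc)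
    qed
    ultimately show ?thesis
      unfolding partial_eq[OF F] by (rule vector_derivative_unique_at)
  qed
  show ?thesis
  proof (rule has_vector_derivative_transform_within_open)
    have "deriv A holomorphic_on ball 0 r" by (intro holomorphic_deriv A open_ball)
    from line[OF this, of 0 d]
    show "((\<lambda>t. Re (d * deriv A (t *\<^sub>R d))) has_vector_derivative Re (d * d * deriv (deriv A) 0)) (at 0)"
      using r by (simp add: mult.assoc)
    show "open {- r<..<r}" "0 \<in> {- r<..<r}" using r by auto
    fix t assume "t \<in> {- r<..<r}"
    then have "t *\<^sub>R d \<in> ball 0 r" using d by auto
    from first[OF this]
    show "Re (d * deriv A (t *\<^sub>R d)) = \<L> (partial (h0_plane d) f (w + t *\<^sub>R h0_plane d))"
      by (simp add: h0_plane_scaleR)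
  qed
qed

lemma hyper0_has_vector_derivative:
  assumes "((\<lambda>t. cmp1 (g t)) has_vector_derivative cmp1 v) (at x)"
    and "((\<lambda>t. cmp2 (g t)) has_vector_derivative cmp2 v) (at x)"
    and "((\<lambda>t. cmp3 (g t)) has_vector_derivative cmp3 v) (at x)"
    and "((\<lambda>t. cmp4 (g t)) has_vector_derivative cmp4 v) (at x)"
  shows "(g has_vector_derivative v) (at x)"
proof -
  have "((\<lambda>t. cmp1 (g t) *\<^sub>R 1 + cmp2 (g t) *\<^sub>R h0_i + cmp3 (g t) *\<^sub>R h0_j + cmp4 (g t) *\<^sub>R h0_k)
      has_vector_derivative cmp1 v *\<^sub>R 1 + cmp2 v *\<^sub>R h0_i + cmp3 v *\<^sub>R h0_j + cmp4 v *\<^sub>R h0_k) (at x)"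
    by (intro has_vector_derivative_add bounded_linear.has_vector_derivative[OF bounded_linear_scaleR_left] assms)
  then show ?thesis by (simp flip: hyper0_expansion)
qed

lemma bounded_linear_cmp:
  "bounded_linear cmp1" "bounded_linear cmp2" "bounded_linear cmp3" "bounded_linear cmp4"
  by (simp_all add: linear_conv_bounded_linear[symmetric] linear_iff)

theorem theorem50:
  fixes U :: "hyper0 set" and f :: "hyper0 \<Rightarrow> hyper0"
  assumes "openin h0_topology U" and "connectedin h0_topology U"
    and "f \<in> F0 U"
    and "left_regular0 U f"
  shows "harmonic0 U f"
  unfolding harmonic0_def
proof (intro conjI ballI)
  show "f \<in> F0 U" by fact
  fix w assume w: "w \<in> U"
  have U: "open U" by (rule openin_h0_topology_imp_open[OF assms(1)])
  then obtain \<rho> where \<rho>: "\<rho> > 0" "cball w \<rho> \<subseteq> U"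
    using w open_contains_cball by blast
  have f: "f differentiable at x \<and> nabla0 f x = 0" if "x \<in> U" for x
    using assms(3,4) that U by (auto simp: F0_def left_regular0_def differentiable_on_eq_differentiable_at)
  have cont: "continuous_on (cball w \<rho>) f"
    using f \<rho>(2) by (intro continuous_at_imp_continuous_on) (auto intro: differentiable_imp_continuous_within)
  have ball: "f differentiable at x \<and> nabla0 f x = 0" if "x \<in> ball w \<rho>" for x
    using that \<rho>(2) by (intro f subsetD[OF \<rho>(2)]) simp
  have "\<exists>A. A holomorphic_on ball 0 (\<rho> / 2) \<and> (\<forall>z\<in>ball 0 (\<rho> / 2). Re (A z) = \<L> (f (w + h0_plane z)))"
    if "bounded_linear \<L>" for \<L>
    by (rule left_regular_eq_Re_holomorphic[OF \<rho>(1) cont ball that])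
  then obtain A where A: "\<And>\<L>. bounded_linear \<L> \<Longrightarrow> A \<L> holomorphic_on ball 0 (\<rho> / 2)"
    "\<And>\<L> z. bounded_linear \<L> \<Longrightarrow> z \<in> ball 0 (\<rho> / 2) \<Longrightarrow> Re (A \<L> z) = \<L> (f (w + h0_plane z))"
    by metis
  have diff: "f differentiable at (w + h0_plane z)" if "z \<in> ball 0 (\<rho> / 2)" for z
    using \<rho>(1) that by (intro conjunct1[OF ball]) (simp add: dist_norm norm_h0_plane)
  \<comment> \<open>\<open>A\<close> depends on the functional; the four coordinate functionals
    yield the components of the second derivative.\<close>
  define c where "c = (\<lambda>d \<L>. Re (d * d * deriv (deriv (A \<L>)) 0))"
  define D where "D = (\<lambda>d. Hyper0 (c d cmp1) (c d cmp2) (c d cmp3) (c d cmp4))"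
  \<comment> \<open>This gives existence as well as the value of the second partial
    derivatives.\<close>
  have second: "((\<lambda>t. partial (h0_plane d) f (w + t *\<^sub>R h0_plane d)) has_vector_derivative D d) (at 0)"
    if "norm d = 1" for d
    using \<rho>(1) A diff that unfolding D_def
    by (intro hyper0_has_vector_derivative; simp only: hyper0.sel c_def;
        intro second_partial_component[where r = "\<rho> / 2"] bounded_linear_cmp)
       (auto simp: bounded_linear_cmp)
  \<comment> \<open>The factors \<open>d * d\<close> are 1 and -1 for the two directions, so the
    contributions of \<open>deriv (deriv (A \<L>)) 0\<close> cancel.\<close>
  have D: "D 1 + D \<i> = 0"
    by (simp add: D_def c_def hyper0_eq_iff)
  show "partial_differentiable 1 (partial 1 f) w" "partial_differentiable h0_i (partial h0_i f) w"
    using second[of 1] second[of \<i>] unfolding partial_differentiable_def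
    by (auto intro: differentiableI_vector)
  have "partial 1 (partial 1 f) w = D 1" "partial h0_i (partial h0_i f) w = D \<i>"
    using second[of 1] second[of \<i>] unfolding partial_def[of _ "partial _ f"]
    by (auto intro: vector_derivative_at)
  then show "Delta0 f w = 0" using D by (simp add: Delta0_def)
qed

end
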